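(* Let $F=0$ be a binary implicit differential equation with surface $\mathcal{V}^F=\{F=0\}\subset J^1(\mathbb{R},\mathbb{R})$, criminant $\widehat{D}$, discriminant $D$, $\pi^\vee$-contour $\widehat{I}$ and curve of inflections $I$. Let $(x,y)$ be a folded singular point of $F=0$, with characteristic point $Q=(x,y,p)$, such that at $Q$: (a) the criminant $\widehat{D}$ is not tangent to the $\pi^\vee$-contour $\widehat{I}$ of $\mathcal{V}^F$; (b) the $\pi^\vee$-fibre through $Q$ is not tangent to $\widehat{I}$; (c) the $\pi$-fibre through $Q$ is not tangent to $\widehat{I}$. Then: (i) the curve of inflections $I$ is quadratically tangent to the discriminant $D$ at $(x,y)$; (ii) the point $(x,y)$ locally separates $I$ into its left and right branches $I_\ell$ and $I_r$.
   Context: All maps and manifolds are smooth. $J^1(\mathbb{R},\mathbb{R})$ is $\mathbb{R}^3$ with coordinates $(x,y,p)$ and contact structure $\ker(p\,dx-dy)$. The standard Legendrian fibration is $\pi(x,y,p)=(x,y)$ and the standard dual fibration is $\pi^\vee(x,y,p)=(p,px-y)$; the $\pi^\vee$-fibre over $(a,b)$ is the curve $x\mapsto(x,ax-b,a)$. A binary implicit differential equation (BIDE) is $F(x,y,p)=a(x,y)+2b(x,y)p+c(x,y)p^2=0$, with $p=dy/dx$. Standing assumption: $F_{pp}\neq0$ at the points where $F=F_p=0$ (the $\pi$-fibre has exactly 2-point contact with $\mathcal{V}^F$ there). A characteristic point of $\mathcal{V}^F$ is a point where $\mathcal{V}^F$ is smooth and its tangent plane coincides with the contact plane (i.e. $F=0$,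 $dF\neq0$, $F_p=0$, $F_x+pF_y=0$); its image by $\pi$ is a folded singular point. At the other points of the smooth surface $\mathcal{V}^F$ the intersection of the tangent plane with the contact plane is the characteristic line; the integral curves of this line field are the characteristics and their projections by $\pi$ are the solution curves. The criminant ($\pi$-contour) $\widehat{D}$ is the set of critical points of $\pi|_{\mathcal{V}^F}$, and $D=\pi(\widehat{D})$ is the discriminant. The $\pi^\vee$-contour $\widehat{I}$ is the set of critical points of $\pi^\vee|_{\mathcal{V}^F}$. The curve of inflections $I=\pi(\widehat{I})$ consists of the inflections of the solution curves (an inflection is a point of at least 3-point contact with the tangent line). Orient $\mathcal{V}^F$ and the $(x,y)$-plane: $\widehat{D}$ separates $\mathcal{V}^F$ into the left part (where $\pi|_{\mathcal{V}^F}$ reverses the orientation) and the right part (where it preserves it); solutions coming from the left (right) part are called left (right), and $I_\ell$ (resp. $I_r$) consists of the inflections of the left (resp. right) solutions. "Quadratically tangent" means tangent with exactly 2-point contact. *)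

theory Defs
  imports "HOL-Analysis.Analysis"
begin

section \<open>Smooth maps and curves\<close>

primrec Ck_on :: "nat \<Rightarrow> 'a::real_normed_vector set \<Rightarrow> ('a \<Rightarrow> 'b::real_normed_vector) \<Rightarrow> bool" where
  "Ck_on 0 S f \<longleftrightarrow> continuous_on S f"
| "Ck_on (Suc k) S f \<longleftrightarrow>
     (\<forall>x\<in>S. f differentiable at x) \<and> (\<forall>v. Ck_on k S (\<lambda>x. frechet_derivative f (at x) v))"

text \<open>Only meant for open sets, since the derivatives are taken \<open>at x\<close> and not \<open>at x within S\<close>.\<close>

definition smooth_on :: "'a::real_normed_vector set \<Rightarrow> ('a \<Rightarrow> 'b::real_normed_vector) \<Rightarrow> bool" where
  "smooth_on S f \<longleftrightarrow> (\<forall>k. Ck_on k S f)"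

text \<open>\<open>\<sigma>\<close> is a regular parametrisation, by the interval \<open>(-\<epsilon>, \<epsilon>)\<close>, of the part of \<open>S\<close> in the
  neighbourhood \<open>U\<close> of \<open>P = \<sigma> 0\<close>. The homeomorphism condition makes \<open>S \<inter> U\<close> an embedded
  one-dimensional submanifold.\<close>

definition curve_param ::
  "'a::real_normed_vector set \<Rightarrow> 'a \<Rightarrow> (real \<Rightarrow> 'a) \<Rightarrow> real \<Rightarrow> 'a set \<Rightarrow> bool" where
  "curve_param S P \<sigma> \<epsilon> U \<longleftrightarrow>
     \<epsilon> > 0 \<and> open U \<and> \<sigma> 0 = P \<and> smooth_on {-\<epsilon><..<\<epsilon>} \<sigma> \<and>
     (\<forall>t\<in>{-\<epsilon><..<\<epsilon>}. vector_derivative \<sigma> (at t) \<noteq> 0) \<and>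
     (\<exists>\<tau>. homeomorphism {-\<epsilon><..<\<epsilon>} (S \<inter> U) \<sigma> \<tau>)"

definition smooth_curve_at :: "'a::real_normed_vector set \<Rightarrow> 'a \<Rightarrow> bool" where
  "smooth_curve_at S P \<longleftrightarrow> (\<exists>\<sigma> \<epsilon> U. curve_param S P \<sigma> \<epsilon> U)"

definition tangent_line :: "'a::real_normed_vector set \<Rightarrow> 'a \<Rightarrow> 'a set" where
  "tangent_line S P =
     {v. \<exists>\<sigma> \<epsilon> U. curve_param S P \<sigma> \<epsilon> U \<and> v \<in> span {vector_derivative \<sigma> (at 0)}}"

definition tangent_at :: "'a::real_normed_vector set \<Rightarrow> 'a set \<Rightarrow> 'a \<Rightarrow> bool" where
  "tangent_at S T P \<longleftrightarrow>
     smooth_curve_at S P \<and> smooth_curve_at T P \<and> tangent_line S P = tangent_line T P"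

text \<open>Saying that two curves through \<open>P\<close> are not tangent presupposes that both of them have a
  tangent line at \<open>P\<close>, so this is not the mere negation of \<open>tangent_at\<close>. (A contour may degenerate
  to an isolated point; the mere negation would then hold vacuously.)\<close>

definition not_tangent_at :: "'a::real_normed_vector set \<Rightarrow> 'a set \<Rightarrow> 'a \<Rightarrow> bool" where
  "not_tangent_at S T P \<longleftrightarrow>
     smooth_curve_at S P \<and> smooth_curve_at T P \<and> tangent_line S P \<noteq> tangent_line T P"

section \<open>Contact of plane curves\<close>

type_synonym plane = "real \<times> real"

definition local_equation :: "plane set \<Rightarrow> plane \<Rightarrow> (plane \<Rightarrow> real) \<Rightarrow> plane set \<Rightarrow> bool" where
  "local_equation T P g W \<longleftrightarrow>
     open W \<and> P \<in> W \<and> smooth_on W g \<and>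
     (\<forall>z\<in>W. frechet_derivative g (at z) \<noteq> (\<lambda>_. 0)) \<and> T \<inter> W = {z \<in> W. g z = 0}"

text \<open>A parametrised curve has (at least, exactly) \<open>k\<close>-point contact with \<open>{g = 0}\<close> if \<open>g\<close> restricted
  to the curve has a zero of multiplicity (at least, exactly) \<open>k\<close>. This depends neither on the regular
  parametrisation nor on the regular equation.\<close>

definition zero_mult_at_least :: "nat \<Rightarrow> (real \<Rightarrow> real) \<Rightarrow> real \<Rightarrow> bool" where
  "zero_mult_at_least k h t \<longleftrightarrow> (\<forall>j<k. (deriv ^^ j) h t = 0)"

definition exact_contact :: "nat \<Rightarrow> plane set \<Rightarrow> plane set \<Rightarrow> plane \<Rightarrow> bool" where
  "exact_contact k S T P \<longleftrightarrow>
     (\<exists>\<sigma> \<epsilon> U g W. curve_param S P \<sigma> \<epsilon> U \<and> local_equation T P g W \<and>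
        zero_mult_at_least k (g \<circ> \<sigma>) 0 \<and> (deriv ^^ k) (g \<circ> \<sigma>) 0 \<noteq> 0)"

definition quadratically_tangent :: "plane set \<Rightarrow> plane set \<Rightarrow> plane \<Rightarrow> bool" where
  "quadratically_tangent S T P \<longleftrightarrow> tangent_at S T P \<and> exact_contact 2 S T P"

definition det2 :: "plane \<Rightarrow> plane \<Rightarrow> real" where
  "det2 u v = fst u * snd v - snd u * fst v"

definition inflection :: "(real \<Rightarrow> plane) \<Rightarrow> real \<Rightarrow> bool" where
  "inflection \<delta> t \<longleftrightarrow>
     zero_mult_at_least 3 (\<lambda>s. det2 (vector_derivative \<delta> (at t)) (\<delta> s - \<delta> t)) t"

section \<open>The space of 1-jets and its two Legendrian fibrations\<close>

type_synonym jet = "real \<times> real \<times> real"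

fun legendre :: "jet \<Rightarrow> plane" where
  "legendre (x, y, p) = (x, y)"

fun dual_legendre :: "jet \<Rightarrow> plane" where
  "dual_legendre (x, y, p) = (p, p * x - y)"

definition fibre :: "(jet \<Rightarrow> plane) \<Rightarrow> jet \<Rightarrow> jet set" where
  "fibre \<pi> Q = \<pi> -` {\<pi> Q}"

fun contact_plane :: "jet \<Rightarrow> jet set" where
  "contact_plane (x, y, p) = {(dx, dy, dp). p * dx - dy = 0}"

fun det3 :: "jet \<Rightarrow> jet \<Rightarrow> jet \<Rightarrow> real" where
  "det3 (a1, a2, a3) (b1, b2, b3) (c1, c2, c3) =
     a1 * (b2 * c3 - b3 * c2) - a2 * (b1 * c3 - b3 * c1) + a3 * (b1 * c2 - b2 * c1)"

section \<open>Binary implicit differential equations\<close>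

fun bide :: "(plane \<Rightarrow> real) \<Rightarrow> (plane \<Rightarrow> real) \<Rightarrow> (plane \<Rightarrow> real) \<Rightarrow> jet \<Rightarrow> real" where
  "bide a b c (x, y, p) = a (x, y) + 2 * b (x, y) * p + c (x, y) * p\<^sup>2"

definition deriv_p :: "(jet \<Rightarrow> real) \<Rightarrow> jet \<Rightarrow> real" where
  "deriv_p F q = frechet_derivative F (at q) (0, 0, 1)"

text \<open>The points where the surface \<open>F = 0\<close> is smooth.\<close>

definition regular_part :: "(jet \<Rightarrow> real) \<Rightarrow> jet set" where
  "regular_part F = {q. F q = 0 \<and> frechet_derivative F (at q) \<noteq> (\<lambda>_. 0)}"

definition tangent_plane :: "(jet \<Rightarrow> real) \<Rightarrow> jet \<Rightarrow> jet set" where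
  "tangent_plane F q = {v. frechet_derivative F (at q) v = 0}"

definition characteristic_point :: "(jet \<Rightarrow> real) \<Rightarrow> jet \<Rightarrow> bool" where
  "characteristic_point F q \<longleftrightarrow> q \<in> regular_part F \<and> tangent_plane F q = contact_plane q"

text \<open>Critical points of the restriction of \<open>\<pi>\<close> to the surface.\<close>

definition contour :: "(jet \<Rightarrow> plane) \<Rightarrow> (jet \<Rightarrow> real) \<Rightarrow> jet set" where
  "contour \<pi> F =
     {q \<in> regular_part F. frechet_derivative \<pi> (at q) ` tangent_plane F q \<noteq> UNIV}"

definition criminant :: "(jet \<Rightarrow> real) \<Rightarrow> jet set" where
  "criminant F = contour legendre F"

definition discriminant :: "(jet \<Rightarrow> real) \<Rightarrow> plane set" where
  "discriminant F = legendre ` criminant F"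

definition dual_contour :: "(jet \<Rightarrow> real) \<Rightarrow> jet set" where
  "dual_contour F = contour dual_legendre F"

definition inflection_curve :: "(jet \<Rightarrow> real) \<Rightarrow> plane set" where
  "inflection_curve F = legendre ` dual_contour F"

definition characteristic :: "(jet \<Rightarrow> real) \<Rightarrow> (real \<Rightarrow> jet) \<Rightarrow> real \<Rightarrow> bool" where
  "characteristic F \<gamma> \<epsilon> \<longleftrightarrow>
     \<epsilon> > 0 \<and> smooth_on {-\<epsilon><..<\<epsilon>} \<gamma> \<and>
     (\<forall>t\<in>{-\<epsilon><..<\<epsilon>}. \<gamma> t \<in> regular_part F \<and> \<not> characteristic_point F (\<gamma> t) \<and>
        vector_derivative \<gamma> (at t) \<noteq> 0 \<and>
        vector_derivative \<gamma> (at t) \<in> tangent_plane F (\<gamma> t) \<inter> contact_plane (\<gamma> t))"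

text \<open>An orientation of the surface is given by a nowhere zero continuous normal field \<open>n\<close>: a basis
  \<open>u, v\<close> of the tangent plane is positive if \<open>det3 n u v > 0\<close>. The orientation of the \<open>(x,y)\<close>-plane is
  given by a sign \<open>s\<close>: a basis \<open>u, v\<close> is positive if \<open>s * det2 u v > 0\<close>.\<close>

definition orientation :: "(jet \<Rightarrow> real) \<Rightarrow> (jet \<Rightarrow> jet) \<Rightarrow> bool" where
  "orientation F n \<longleftrightarrow> continuous_on (regular_part F) n \<and>
     (\<forall>q\<in>regular_part F. n q \<noteq> 0 \<and> (\<forall>v\<in>tangent_plane F q. n q \<bullet> v = 0))"

definition left_part :: "(jet \<Rightarrow> real) \<Rightarrow> (jet \<Rightarrow> jet) \<Rightarrow> real \<Rightarrow> jet set" where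
  "left_part F n s = {q \<in> regular_part F.
     \<forall>u\<in>tangent_plane F q. \<forall>v\<in>tangent_plane F q. det3 (n q) u v > 0 \<longrightarrow>
       s * det2 (frechet_derivative legendre (at q) u) (frechet_derivative legendre (at q) v) < 0}"

definition right_part :: "(jet \<Rightarrow> real) \<Rightarrow> (jet \<Rightarrow> jet) \<Rightarrow> real \<Rightarrow> jet set" where
  "right_part F n s = {q \<in> regular_part F.
     \<forall>u\<in>tangent_plane F q. \<forall>v\<in>tangent_plane F q. det3 (n q) u v > 0 \<longrightarrow>
       s * det2 (frechet_derivative legendre (at q) u) (frechet_derivative legendre (at q) v) > 0}"

text \<open>The inflections of the solutions coming from the part \<open>L\<close> of the surface. Restricting to the
  parameter value \<open>0\<close> is no loss, as characteristics can be translated and shortened.\<close>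

definition inflections_of_solutions :: "(jet \<Rightarrow> real) \<Rightarrow> jet set \<Rightarrow> plane set" where
  "inflections_of_solutions F L =
     {legendre (\<gamma> 0) | \<gamma> \<epsilon>. characteristic F \<gamma> \<epsilon> \<and> \<gamma> ` {-\<epsilon><..<\<epsilon>} \<subseteq> L \<and> inflection (legendre \<circ> \<gamma>) 0}"

text \<open>\<open>P\<close> locally separates the curve \<open>S\<close> into the branches \<open>A\<close> and \<open>B\<close>. Prescribing which of them
  is parametrised by \<open>t < 0\<close> is no loss, as the parametrisation can be reversed.\<close>

definition locally_separates :: "'a::real_normed_vector \<Rightarrow> 'a set \<Rightarrow> 'a set \<Rightarrow> 'a set \<Rightarrow> bool" where
  "locally_separates P S A B \<longleftrightarrow>
     (\<exists>\<sigma> \<epsilon> U. curve_param S P \<sigma> \<epsilon> U \<and>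
        A \<inter> U = \<sigma> ` {-\<epsilon><..<0} \<and> B \<inter> U = \<sigma> ` {0<..<\<epsilon>})"

end

theory Submission
  imports Defs
begin

text \<open>Write \<open>m = b + c p = F\<^sub>p / 2\<close> and \<open>\<Delta> = b\<^sup>2 - a c\<close>. Identically \<open>\<Delta> = m\<^sup>2 - c F\<close>, so on the
  surface \<open>\<Delta> = m\<^sup>2\<close>, and \<open>\<Delta> = 0\<close> is a regular equation of the discriminant because \<open>F\<^sub>y \<noteq> 0\<close> at a
  characteristic point. Both contours are curves whose tangents at \<open>Q\<close> lie in the contact plane and are
  not vertical, so their projections are regular curves with the same tangent line. Along the
  \<open>\<pi>\<^sup>\<or>\<close>-contour \<open>m\<close> has a simple zero at \<open>Q\<close>, as the contours are transversal: hence \<open>\<Delta>\<close> has a double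
  zero there, which is the quadratic tangency, and \<open>F\<^sub>p\<close>, whose sign tells left from right, changes
  sign, which is the separation. Away from the criminant, the inflections of the solutions are the
  points of the \<open>\<pi>\<^sup>\<or>\<close>-contour; that each such point lies on a characteristic follows from solving
  \<open>F = 0\<close> for \<open>p\<close> and integrating \<open>dy/dx = p(x, y)\<close>.\<close>

section \<open>Calculus of smooth maps\<close>

text \<open>The linear algebra takes place in the contact plane at \<open>Q\<close>. On it the
  kernel of the differential of \<open>F\<^sub>p\<close> is a line, since
  \<open>F\<^sub>p\<^sub>p\<close> does not vanish; that line is the tangent of the criminant, which
  is therefore not vertical. The tangent of the \<open>\<pi>\<^sup>\<or>\<close>-contour is not
  vertical because the contour is transversal to the \<open>\<pi>\<close>-fibre; being different
  from the tangent of the criminant, it lies outside the kernel, whence the simple zero. The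
  obstacle is the passage from embedded space curves to embedded plane curves: remote points of a
  contour could project close to the image of \<open>Q\<close>. The quadratic form of the equation
  excludes this, because near that image \<open>c\<close> is nonzero, \<open>p\<close> is one of two
  roots, and both roots tend to the double root at \<open>Q\<close>. The branches are defined by
  genuine smooth characteristics, not by points of the contour, so a local existence theorem with
  smooth solutions is proved as well. Tangent lines are defined through all parametrisations at
  once, which calls for a proof that the parametrisation does not matter.\<close>

lemma Ck_on_cong:
  assumes "open S" "\<And>x. x \<in> S \<Longrightarrow> f x = g x"
  shows "Ck_on k S f \<longleftrightarrow> Ck_on k S g"
  using assms(2)
proof (induction k arbitrary: f g)
  case 0
  then show ?case by (simp cong: continuous_on_cong)
next
  case (Suc k)
  have diff: "f differentiable at x \<longleftrightarrow> g differentiable at x" if "x \<in> S" for x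
    using has_derivative_transform_within_open[OF _ assms(1) that, of f _ UNIV g]
      has_derivative_transform_within_open[OF _ assms(1) that, of g _ UNIV f] Suc.prems
    unfolding differentiable_def by metis
  have fd: "frechet_derivative f (at x) = frechet_derivative g (at x)" if "x \<in> S" for x
  proof -
    have "(f has_derivative f') (at x) \<longleftrightarrow> (g has_derivative f') (at x)" for f'
      using has_derivative_transform_within_open[OF _ assms(1) that, of f _ UNIV g]
        has_derivative_transform_within_open[OF _ assms(1) that, of g _ UNIV f] Suc.prems
      by metis
    then show ?thesis by (simp add: frechet_derivative_def)
  qed
  show ?case
    using diff fd Suc.IH[of "\<lambda>x. frechet_derivative f (at x) v" "\<lambda>x. frechet_derivative g (at x) v" for v]
    by auto
qed

lemma Ck_on_imp_continuous_on: "Ck_on k S f \<Longrightarrow> continuous_on S f"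
  by (cases k) (auto simp: continuous_at_imp_continuous_on differentiable_imp_continuous_within)

lemma Ck_on_SucD: "Ck_on (Suc k) S f \<Longrightarrow> Ck_on k S f"
proof (induction k arbitrary: f)
  case 0
  then show ?case using Ck_on_imp_continuous_on[OF 0] by simp
next
  case (Suc k)
  then show ?case by (metis Ck_on.simps(2))
qed

lemma Ck_on_subset: "Ck_on k S f \<Longrightarrow> T \<subseteq> S \<Longrightarrow> Ck_on k T f"
proof (induction k arbitrary: f)
  case (Suc k)
  show ?case
    using Suc.prems(1) Suc.prems(2) Suc.IH[OF _ Suc.prems(2)] by auto
qed (auto intro: continuous_on_subset)

text \<open>Any formula for the derivative may be supplied. The closure properties below then reduce
  to naming a derivative and recognising it as built from maps of class \<open>k\<close>.\<close>

lemma Ck_on_SucI: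
  assumes "open S" "\<And>x. x \<in> S \<Longrightarrow> (f has_derivative f' x) (at x)" "\<And>v. Ck_on k S (\<lambda>x. f' x v)"
  shows "Ck_on (Suc k) S f"
proof -
  have "frechet_derivative f (at x) = f' x" if "x \<in> S" for x
    using assms(2)[OF that] by (simp add: frechet_derivative_at[symmetric])
  then have "Ck_on k S (\<lambda>x. frechet_derivative f (at x) v)" for v
    using assms(3)[of v] Ck_on_cong[OF assms(1), of "\<lambda>x. frechet_derivative f (at x) v" "\<lambda>x. f' x v" k]
    by simp
  then show ?thesis
    using assms(2) by (auto simp: differentiable_def)
qed

lemma Ck_on_const: "Ck_on k S (\<lambda>x. c)"
  by (induction k arbitrary: c) auto

lemma Ck_on_bounded_linear_compose:
  assumes "open S" "bounded_linear L" "Ck_on k S f"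
  shows "Ck_on k S (\<lambda>x. L (f x))"
  using assms(3)
proof (induction k arbitrary: f)
  case 0
  then show ?case
    using assms(2) by (auto intro: bounded_linear.continuous_on)
next
  case (Suc k)
  show ?case
  proof (rule Ck_on_SucI[OF assms(1), where f' = "\<lambda>x v. L (frechet_derivative f (at x) v)"])
    show "((\<lambda>x. L (f x)) has_derivative (\<lambda>v. L (frechet_derivative f (at x) v))) (at x)" if "x \<in> S" for x
      using Suc.prems that
      by (intro bounded_linear.has_derivative[OF assms(2)]) (auto simp: frechet_derivative_works)
    show "Ck_on k S (\<lambda>x. L (frechet_derivative f (at x) v))" for v
      using Suc by auto
  qed
qed

lemma Ck_on_id: "open S \<Longrightarrow> Ck_on k S (\<lambda>x. x)"
proof (cases k)
  case (Suc j)
  assume "open S"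
  then show ?thesis
    unfolding Suc by (rule Ck_on_SucI[where f' = "\<lambda>x v. v"]) (auto intro: Ck_on_const)
qed auto

lemma Ck_on_bounded_linear: "open S \<Longrightarrow> bounded_linear L \<Longrightarrow> Ck_on k S L"
  using Ck_on_bounded_linear_compose[OF _ _ Ck_on_id, of S L k] by simp

lemma Ck_on_add:
  assumes "open S" "Ck_on k S f" "Ck_on k S g"
  shows "Ck_on k S (\<lambda>x. f x + g x)"
  using assms(2,3)
proof (induction k arbitrary: f g)
  case 0
  then show ?case by (auto intro: continuous_on_add)
next
  case (Suc k)
  show ?case
    by (rule Ck_on_SucI[OF assms(1), where f' = "\<lambda>x v. frechet_derivative f (at x) v + frechet_derivative g (at x) v"])
       (use Suc in \<open>auto simp: frechet_derivative_works intro!: has_derivative_add\<close>)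
qed

lemma Ck_on_sum:
  assumes "open S" "\<And>i. i \<in> I \<Longrightarrow> Ck_on k S (f i)"
  shows "Ck_on k S (\<lambda>x. \<Sum>i\<in>I. f i x)"
  using assms(2)
  by (induction I rule: infinite_finite_induct) (auto intro: Ck_on_const Ck_on_add[OF assms(1)])

text \<open>The product rule yields a sum of terms of the same shape with one factor differentiated,
  so an induction that leaves both factors arbitrary closes.\<close>

lemma Ck_on_bilinear:
  assumes "open S" "bounded_bilinear B" "Ck_on k S f" "Ck_on k S g"
  shows "Ck_on k S (\<lambda>x. B (f x) (g x))"
  using assms(3,4)
proof (induction k arbitrary: f g)
  case 0
  then show ?case using assms(2) by (auto intro: bounded_bilinear.continuous_on)
next
  case (Suc k)
  show ?case
  proof (rule Ck_on_SucI[OF assms(1), where f' = "\<lambda>x v. B (f x) (frechet_derivative g (at x) v)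
      + B (frechet_derivative f (at x) v) (g x)"])
    show "((\<lambda>x. B (f x) (g x)) has_derivative (\<lambda>v. B (f x) (frechet_derivative g (at x) v)
      + B (frechet_derivative f (at x) v) (g x))) (at x)" if "x \<in> S" for x
      using Suc.prems that
      by (intro bounded_bilinear.FDERIV[OF assms(2)]) (auto simp: frechet_derivative_works)
    show "Ck_on k S (\<lambda>x. B (f x) (frechet_derivative g (at x) v)
      + B (frechet_derivative f (at x) v) (g x))" for v
      using Suc.prems Suc.prems[THEN Ck_on_SucD]
      by (intro Ck_on_add Suc.IH assms) auto
  qed
qed

text \<open>\<open>Ck_on\<close> speaks of derivatives in a fixed direction, whereas the chain rule
  applies the derivative of \<open>g\<close> to the moving vector \<open>f'(x) v\<close>. Expanding
  that vector in \<open>Basis\<close> gives a finite sum of products in which every derivative of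
  \<open>g\<close> has a fixed direction; this is why the middle space is Euclidean.\<close>

lemma Ck_on_compose:
  fixes f :: "'a::real_normed_vector \<Rightarrow> 'b::euclidean_space" and g :: "'b \<Rightarrow> 'c::real_normed_vector"
  assumes "open S" "open T" "f ` S \<subseteq> T" "Ck_on k S f" "Ck_on k T g"
  shows "Ck_on k S (\<lambda>x. g (f x))"
  using assms(4,5)
proof (induction k arbitrary: g)
  case 0
  then show ?case
    using continuous_on_compose2[of T g S f] assms(3) by simp
next
  case (Suc k)
  have lin: "linear (frechet_derivative g (at (f x)))" if "x \<in> S" for x
    by (rule linear_frechet_derivative) (use Suc.prems(2) that assms(3) in auto)
  show ?case
  proof (rule Ck_on_SucI[OF assms(1), where f' = "\<lambda>x v. \<Sum>b\<in>Basis.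
      (frechet_derivative f (at x) v \<bullet> b) *\<^sub>R frechet_derivative g (at (f x)) b"])
    fix x assume x: "x \<in> S"
    have "((\<lambda>x. g (f x)) has_derivative (\<lambda>v. frechet_derivative g (at (f x)) (frechet_derivative f (at x) v))) (at x)"
    proof -
      have "(f has_derivative frechet_derivative f (at x)) (at x)"
        using Suc.prems(1) x unfolding frechet_derivative_works[symmetric] by auto
      moreover have "(g has_derivative frechet_derivative g (at (f x))) (at (f x))"
        using Suc.prems(2) x assms(3) unfolding frechet_derivative_works[symmetric] by auto
      ultimately show ?thesis
        by (rule has_derivative_compose)
    qed
    moreover have "frechet_derivative g (at (f x)) w =
      (\<Sum>b\<in>Basis. (w \<bullet> b) *\<^sub>R frechet_derivative g (at (f x)) b)" for w
    proof -
      have "frechet_derivative g (at (f x)) w = frechet_derivative g (at (f x)) (\<Sum>b\<in>Basis. (w \<bullet> b) *\<^sub>R b)"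
        by (simp add: euclidean_representation)
      also have "\<dots> = (\<Sum>b\<in>Basis. (w \<bullet> b) *\<^sub>R frechet_derivative g (at (f x)) b)"
        by (simp only: linear_sum[OF lin[OF x]] linear_scale[OF lin[OF x]])
      finally show ?thesis .
    qed
    ultimately show "((\<lambda>x. g (f x)) has_derivative (\<lambda>v. \<Sum>b\<in>Basis.
      (frechet_derivative f (at x) v \<bullet> b) *\<^sub>R frechet_derivative g (at (f x)) b)) (at x)"
      by (metis (no_types, lifting) ext)
  next
    fix v
    have "Ck_on k S (\<lambda>x. frechet_derivative f (at x) v \<bullet> b)" for b
      by (rule Ck_on_bounded_linear_compose[OF assms(1) bounded_linear_inner_left])
        (use Suc.prems(1) in simp)
    moreover have "Ck_on k S (\<lambda>x. frechet_derivative g (at (f x)) b)" for b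
      by (rule Suc.IH[OF Ck_on_SucD[OF Suc.prems(1)]]) (use Suc.prems(2) in simp)
    ultimately show "Ck_on k S (\<lambda>x. \<Sum>b\<in>Basis.
      (frechet_derivative f (at x) v \<bullet> b) *\<^sub>R frechet_derivative g (at (f x)) b)"
      by (intro Ck_on_sum[OF assms(1)] Ck_on_bilinear[OF assms(1) bounded_bilinear_scaleR])
  qed
qed

lemma Ck_on_Pair:
  fixes f :: "'a::real_normed_vector \<Rightarrow> 'b::real_normed_vector" and g :: "'a \<Rightarrow> 'c::real_normed_vector"
  assumes "open S" "Ck_on k S f" "Ck_on k S g"
  shows "Ck_on k S (\<lambda>x. (f x, g x))"
proof -
  have "bounded_linear (\<lambda>u::'b. (u, 0::'c))" "bounded_linear (\<lambda>u::'c. (0::'b, u))"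
    by (auto intro: bounded_linear_Pair bounded_linear_ident bounded_linear_zero)
  from this[THEN Ck_on_bounded_linear_compose[OF assms(1)]]
  have "Ck_on k S (\<lambda>x. (f x, 0::'c))" "Ck_on k S (\<lambda>x. (0::'b, g x))"
    using assms(2,3) by blast+
  then have "Ck_on k S (\<lambda>x. (f x, 0) + (0, g x))"
    by (rule Ck_on_add[OF assms(1)])
  then show ?thesis by simp
qed

lemma Ck_on_Suc_realI:
  fixes f :: "real \<Rightarrow> 'a::real_normed_vector"
  assumes "open S" "\<And>t. t \<in> S \<Longrightarrow> (f has_vector_derivative f' t) (at t)" "Ck_on k S f'"
  shows "Ck_on (Suc k) S f"
proof (rule Ck_on_SucI[OF assms(1)])
  show "(f has_derivative (\<lambda>v. v *\<^sub>R f' t)) (at t)" if "t \<in> S" for t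
    using assms(2)[OF that] by (simp add: has_vector_derivative_def)
  show "Ck_on k S (\<lambda>t. v *\<^sub>R f' t)" for v
    by (rule Ck_on_bounded_linear_compose[OF assms(1) bounded_linear_scaleR_right assms(3)])
qed

text \<open>The derivative is minus the square of the function itself, so the induction feeds on its
  own hypothesis.\<close>

lemma Ck_on_inverse: "Ck_on k (- {0}) (inverse :: real \<Rightarrow> real)"
proof (induction k)
  case 0
  show ?case by (auto intro: continuous_on_inverse continuous_on_id)
next
  case (Suc k)
  have op: "open (- {0::real})" by (intro open_Compl closed_singleton)
  have "Ck_on k (- {0::real}) (\<lambda>x. (-1) * (inverse x * inverse x))"
    by (rule Ck_on_bounded_linear_compose[OF op bounded_linear_mult_right
        Ck_on_bilinear[OF op bounded_bilinear_mult Suc Suc]])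
  moreover have "(inverse has_vector_derivative (-1) * (inverse x * inverse x)) (at x)"
    if "x \<in> - {0}" for x :: real
    using DERIV_inverse[of x UNIV] that
    by (simp add: has_real_derivative_iff_has_vector_derivative)
  ultimately show ?case
    by (intro Ck_on_Suc_realI[OF op])
qed

text \<open>The derivative is half the inverse of the function itself, and on positive arguments
  \<open>sqrt\<close> stays away from the pole of \<open>inverse\<close>.\<close>

lemma Ck_on_sqrt: "Ck_on k {0<..} sqrt"
proof (induction k)
  case 0
  show ?case by (auto intro: continuous_on_real_sqrt continuous_on_id)
next
  case (Suc k)
  have op: "open {0::real<..}" by simp
  have "Ck_on k {0<..} (\<lambda>x. inverse (sqrt x))"
    by (rule Ck_on_compose[OF op _ _ Suc Ck_on_inverse]) auto
  then have "Ck_on k {0<..} (\<lambda>x. (1/2) * inverse (sqrt x))"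
    by (rule Ck_on_bounded_linear_compose[OF op bounded_linear_mult_right])
  moreover have "(sqrt has_vector_derivative (1/2) * inverse (sqrt x)) (at x)"
    if "x \<in> {0<..}" for x
    using DERIV_real_sqrt[of x] that
    by (simp add: has_real_derivative_iff_has_vector_derivative)
  ultimately show ?case
    by (intro Ck_on_Suc_realI[OF op])
qed

section \<open>Closure properties of smooth maps\<close>

lemma smooth_on_imp_continuous_on: "smooth_on S f \<Longrightarrow> continuous_on S f"
  unfolding smooth_on_def using Ck_on_imp_continuous_on by blast

lemma smooth_on_imp_differentiable:
  assumes "smooth_on S f" "x \<in> S"
  shows "f differentiable at x"
proof -
  have "Ck_on (Suc 0) S f"
    using assms(1) unfolding smooth_on_def by blast
  then show ?thesis
    using assms(2) by simp
qed

lemma smooth_on_has_derivative: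
  "smooth_on S f \<Longrightarrow> x \<in> S \<Longrightarrow> (f has_derivative frechet_derivative f (at x)) (at x)"
  using smooth_on_imp_differentiable frechet_derivative_works by blast

lemma smooth_on_frechet_derivative:
  assumes "smooth_on S f"
  shows "smooth_on S (\<lambda>x. frechet_derivative f (at x) v)"
  unfolding smooth_on_def
proof
  fix k
  have "Ck_on (Suc k) S f"
    using assms unfolding smooth_on_def by blast
  then show "Ck_on k S (\<lambda>x. frechet_derivative f (at x) v)"
    by simp
qed

lemma smooth_on_subset: "smooth_on S f \<Longrightarrow> T \<subseteq> S \<Longrightarrow> smooth_on T f"
  unfolding smooth_on_def using Ck_on_subset by blast

lemma smooth_on_cong:
  "open S \<Longrightarrow> (\<And>x. x \<in> S \<Longrightarrow> f x = g x) \<Longrightarrow> smooth_on S f \<longleftrightarrow> smooth_on S g"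
  unfolding smooth_on_def using Ck_on_cong[of S f g] by blast

lemma smooth_on_const: "smooth_on S (\<lambda>x. c)"
  by (simp add: smooth_on_def Ck_on_const)

lemma smooth_on_bounded_linear: "open S \<Longrightarrow> bounded_linear L \<Longrightarrow> smooth_on S L"
  by (simp add: smooth_on_def Ck_on_bounded_linear)

lemma smooth_on_add: "open S \<Longrightarrow> smooth_on S f \<Longrightarrow> smooth_on S g \<Longrightarrow> smooth_on S (\<lambda>x. f x + g x)"
  by (simp add: smooth_on_def Ck_on_add)

lemma smooth_on_mult:
  fixes f g :: "'a::real_normed_vector \<Rightarrow> real"
  shows "open S \<Longrightarrow> smooth_on S f \<Longrightarrow> smooth_on S g \<Longrightarrow> smooth_on S (\<lambda>x. f x * g x)"
  by (simp add: smooth_on_def Ck_on_bilinear[OF _ bounded_bilinear_mult])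

lemma smooth_on_diff:
  fixes f g :: "'a::real_normed_vector \<Rightarrow> real"
  assumes "open S" "smooth_on S f" "smooth_on S g"
  shows "smooth_on S (\<lambda>x. f x - g x)"
  using smooth_on_add[OF assms(1,2) smooth_on_mult[OF assms(1) smooth_on_const[of S "-1"] assms(3)]]
  by simp

lemma smooth_on_Pair: "open S \<Longrightarrow> smooth_on S f \<Longrightarrow> smooth_on S g \<Longrightarrow> smooth_on S (\<lambda>x. (f x, g x))"
  by (simp add: smooth_on_def Ck_on_Pair)

lemma smooth_on_compose:
  fixes f :: "'a::real_normed_vector \<Rightarrow> 'b::euclidean_space"
  shows "open S \<Longrightarrow> open T \<Longrightarrow> f ` S \<subseteq> T \<Longrightarrow> smooth_on S f \<Longrightarrow> smooth_on T g \<Longrightarrow> smooth_on S (\<lambda>x. g (f x))"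
  unfolding smooth_on_def by (intro allI Ck_on_compose[of S T f _ g]) auto

lemma smooth_on_sqrt:
  assumes "open S" "smooth_on S f" "\<And>x. x \<in> S \<Longrightarrow> f x > 0"
  shows "smooth_on S (\<lambda>x. sqrt (f x))"
  by (rule smooth_on_compose[OF assms(1) _ _ assms(2), of "{0<..}"])
     (use assms(3) in \<open>auto simp: smooth_on_def Ck_on_sqrt\<close>)

lemma smooth_on_divide:
  fixes f g :: "'a::real_normed_vector \<Rightarrow> real"
  assumes "open S" "smooth_on S f" "smooth_on S g" "\<And>x. x \<in> S \<Longrightarrow> g x \<noteq> 0"
  shows "smooth_on S (\<lambda>x. f x / g x)"
proof -
  have "smooth_on S (\<lambda>x. inverse (g x))"
    by (rule smooth_on_compose[OF assms(1) _ _ assms(3), of "- {0}"])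
       (use assms(4) in \<open>auto simp: smooth_on_def Ck_on_inverse\<close>)
  then show ?thesis
    using smooth_on_mult[OF assms(1,2)] by (simp add: divide_inverse)
qed

lemma smooth_on_has_vector_derivative:
  fixes f :: "real \<Rightarrow> 'a::real_normed_vector"
  shows "smooth_on S f \<Longrightarrow> t \<in> S \<Longrightarrow> (f has_vector_derivative vector_derivative f (at t)) (at t)"
  using smooth_on_imp_differentiable[of S f t] by (simp add: vector_derivative_works)

lemma smooth_on_vector_derivative:
  fixes f :: "real \<Rightarrow> 'a::real_normed_vector"
  assumes "open S" "smooth_on S f"
  shows "smooth_on S (\<lambda>t. vector_derivative f (at t))"
proof -
  have "frechet_derivative f (at t) 1 = vector_derivative f (at t)" if "t \<in> S" for t
    using smooth_on_imp_differentiable[OF assms(2) that]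
    by (simp add: frechet_derivative_eq_vector_derivative)
  then show ?thesis
    using smooth_on_frechet_derivative[OF assms(2), of 1]
      smooth_on_cong[OF assms(1), of "\<lambda>t. frechet_derivative f (at t) 1" "\<lambda>t. vector_derivative f (at t)"]
    by simp
qed

text \<open>Bootstrapping: if \<phi> is of class \<open>k\<close>, then so is the right-hand side
  \<open>f (x, \<phi> x)\<close>, which is the derivative of \<phi>.\<close>

lemma smooth_on_ode_solution:
  fixes f :: "real \<times> real \<Rightarrow> real"
  assumes "open W" "smooth_on W f" "open T"
    and "\<And>x. x \<in> T \<Longrightarrow> (x, \<phi> x) \<in> W"
    and "\<And>x. x \<in> T \<Longrightarrow> (\<phi> has_real_derivative f (x, \<phi> x)) (at x)"
  shows "smooth_on T \<phi>"
  unfolding smooth_on_def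
proof
  fix k show "Ck_on k T \<phi>"
  proof (induction k)
    case 0
    show ?case
      using assms(5) by (auto intro!: continuous_at_imp_continuous_on DERIV_isCont)
  next
    case (Suc k)
    have "(\<lambda>x. (x, \<phi> x)) ` T \<subseteq> W" "Ck_on k T (\<lambda>x. (x, \<phi> x))" "Ck_on k W f"
      using assms(2,4) Ck_on_Pair[OF assms(3) Ck_on_id[OF assms(3)] Suc] by (auto simp: smooth_on_def)
    then have "Ck_on k T (\<lambda>x. f (x, \<phi> x))"
      by (rule Ck_on_compose[OF assms(3,1)])
    then show ?case
      by (rule Ck_on_Suc_realI[OF assms(3), rotated])
         (use assms(5) in \<open>simp add: has_real_derivative_iff_has_vector_derivative\<close>)
  qed
qed

section \<open>Local solutions of ordinary differential equations\<close>

text \<open>Picard iteration, carried out in the complete space of bounded continuous functions on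
  the whole line. Clamping both the arguments of \<open>f\<close> and the time variable removes
  every domain condition from the iteration.\<close>

lemma lipschitz_ode_local_solution:
  fixes f :: "real \<times> real \<Rightarrow> real"
  assumes "r > 0" and cont: "continuous_on ({x0-r..x0+r} \<times> {y0-r..y0+r}) f"
    and lip: "\<And>x y z. x \<in> {x0-r..x0+r} \<Longrightarrow> y \<in> {y0-r..y0+r} \<Longrightarrow> z \<in> {y0-r..y0+r} \<Longrightarrow>
      \<bar>f (x, y) - f (x, z)\<bar> \<le> L * \<bar>y - z\<bar>" and "L \<ge> 0"
  shows "\<exists>h>0. \<exists>\<phi>. \<phi> x0 = y0 \<and> (\<forall>x\<in>{x0-h<..<x0+h}. (x, \<phi> x) \<in> {x0-r..x0+r} \<times> {y0-r..y0+r} \<and>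
    (\<phi> has_real_derivative f (x, \<phi> x)) (at x))"
proof -
  \<comment> \<open>The point is moved to the nearest point of the square. Clamping is 1-Lipschitz,
    so \<open>g\<close> keeps the constant \<open>L\<close> and is defined everywhere.\<close>
  define g where "g = (\<lambda>x y. f (max (x0-r) (min (x0+r) x), max (y0-r) (min (y0+r) y)))"
  have g_cont: "continuous_on UNIV (\<lambda>t. g t (\<phi> t))" if "continuous_on UNIV \<phi>" for \<phi>
    unfolding g_def
    by (rule continuous_on_compose2[OF cont])
       (use that \<open>r > 0\<close> in \<open>auto intro!: continuous_on_Pair continuous_on_max continuous_on_min
          continuous_on_const continuous_on_id\<close>)
  have g_lip: "\<bar>g x y - g x z\<bar> \<le> L * \<bar>y - z\<bar>" for x y z
  proof -
    have "\<bar>g x y - g x z\<bar> \<le> L * \<bar>max (y0-r) (min (y0+r) y) - max (y0-r) (min (y0+r) z)\<bar>"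
      unfolding g_def using \<open>r > 0\<close> by (intro lip) auto
    also have "\<dots> \<le> L * \<bar>y - z\<bar>"
      using \<open>L \<ge> 0\<close> by (intro mult_left_mono) auto
    finally show ?thesis .
  qed
  \<comment> \<open>The Picard operator is a difference of two integrals over intervals of length at
    most \<open>2 * h\<close>. The bound 1/4 for each makes it a contraction with factor 1/2; the
    summand 1 covers the case \<open>L = 0\<close>.\<close>
  define h where "h = min r (1 / (8 * (L + 1)))"
  have h: "h > 0" "h \<le> r" "L * (2 * h) \<le> 1/4"
  proof -
    show "h > 0" "h \<le> r" using \<open>r > 0\<close> \<open>L \<ge> 0\<close> by (auto simp: h_def)
    have "L * (2 * h) \<le> L * (2 * (1 / (8 * (L + 1))))"
      using \<open>L \<ge> 0\<close> by (intro mult_left_mono) (auto simp: h_def)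
    also have "\<dots> \<le> 1/4" using \<open>L \<ge> 0\<close> by (simp add: field_simps)
    finally show "L * (2 * h) \<le> 1/4" .
  qed
  define c where "c = (\<lambda>x. max (x0-h) (min (x0+h) x))"
  have c: "c x \<in> {x0-h..x0+h}" "x \<in> {x0-h..x0+h} \<Longrightarrow> c x = x" for x
    using h by (auto simp: c_def)
  have c_cont: "continuous_on UNIV c"
    unfolding c_def by (intro continuous_on_max continuous_on_min continuous_on_const continuous_on_id)
  \<comment> \<open>Integrating from the left end \<open>x0 - h\<close> treats both sides of
    \<open>x0\<close> alike; subtracting the value at \<open>x0\<close> in \<open>T\<close> restores
    the initial condition.\<close>
  define A where "A = (\<lambda>\<phi> u. integral {x0-h..u} (\<lambda>t. g t (\<phi> t)))"
  define T where "T = (\<lambda>\<phi> x. y0 + A \<phi> (c x) - A \<phi> x0)"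
  have A_cont: "continuous_on {x0-h..x0+h} (A \<phi>)" if "continuous_on UNIV \<phi>" for \<phi>
    unfolding A_def
    by (intro indefinite_integral_continuous_1 integrable_continuous_real
        continuous_on_subset[OF g_cont[OF that]]) auto
  have T_bcontfun: "T \<phi> \<in> bcontfun" if "continuous_on UNIV \<phi>" for \<phi>
  proof -
    have "continuous_on UNIV (\<lambda>x. A \<phi> (c x))"
      using c(1) by (intro continuous_on_compose2[OF A_cont[OF that] c_cont]) auto
    then have "continuous_on UNIV (T \<phi>)"
      unfolding T_def by (intro continuous_on_diff continuous_on_add continuous_on_const)
    moreover have "bounded (range (T \<phi>))"
    proof -
      have "compact ((\<lambda>u. y0 + A \<phi> u - A \<phi> x0) ` {x0-h..x0+h})"
        by (intro compact_continuous_image continuous_on_diff continuous_on_add continuous_on_const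
            A_cont that compact_Icc)
      moreover have "range (T \<phi>) \<subseteq> (\<lambda>u. y0 + A \<phi> u - A \<phi> x0) ` {x0-h..x0+h}"
        using c(1) by (auto simp: T_def)
      ultimately show ?thesis
        using bounded_subset compact_imp_bounded by blast
    qed
    ultimately show ?thesis by (simp add: bcontfun_def)
  qed
  define TT where "TT = (\<lambda>\<phi>::real \<Rightarrow>\<^sub>C real. Bcontfun (T (apply_bcontfun \<phi>)))"
  have TT: "apply_bcontfun (TT \<phi>) = T (apply_bcontfun \<phi>)" for \<phi>
    unfolding TT_def by (rule Bcontfun_inverse[OF T_bcontfun]) simp
  have A_diff: "\<bar>A (apply_bcontfun \<phi>) u - A (apply_bcontfun \<psi>) u\<bar> \<le> 1/4 * dist \<phi> \<psi>"
    if "u \<in> {x0-h..x0+h}" for \<phi> \<psi> :: "real \<Rightarrow>\<^sub>C real" and u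
  proof -
    have ct: "continuous_on {x0-h..u} (\<lambda>t. g t (apply_bcontfun \<theta> t))" for \<theta>
      by (rule continuous_on_subset[OF g_cont]) auto
    have "A (apply_bcontfun \<phi>) u - A (apply_bcontfun \<psi>) u
        = integral {x0-h..u} (\<lambda>t. g t (apply_bcontfun \<phi> t) - g t (apply_bcontfun \<psi> t))"
      unfolding A_def by (intro integral_diff[symmetric] integrable_continuous_real ct)
    also have "\<bar>\<dots>\<bar> \<le> (L * dist \<phi> \<psi>) * (u - (x0 - h))"
    proof (rule integral_bound[where 'a = real, unfolded real_norm_def])
      fix t
      have "\<bar>g t (apply_bcontfun \<phi> t) - g t (apply_bcontfun \<psi> t)\<bar>
          \<le> L * \<bar>apply_bcontfun \<phi> t - apply_bcontfun \<psi> t\<bar>" by (rule g_lip)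
      also have "\<dots> \<le> L * dist \<phi> \<psi>"
        using dist_bounded[of \<phi> t \<psi>] \<open>L \<ge> 0\<close> by (intro mult_left_mono) (auto simp: dist_real_def)
      finally show "\<bar>g t (apply_bcontfun \<phi> t) - g t (apply_bcontfun \<psi> t)\<bar> \<le> L * dist \<phi> \<psi>" .
    qed (use that ct in \<open>auto intro: continuous_on_diff\<close>)
    also have "\<dots> \<le> (L * dist \<phi> \<psi>) * (2 * h)"
      using that \<open>L \<ge> 0\<close> by (intro mult_left_mono) auto
    also have "\<dots> = (L * (2 * h)) * dist \<phi> \<psi>" by simp
    also have "\<dots> \<le> 1/4 * dist \<phi> \<psi>"
      using h(3) by (intro mult_right_mono) auto
    finally show ?thesis .
  qed
  have "dist (TT \<phi>) (TT \<psi>) \<le> 1/2 * dist \<phi> \<psi>" for \<phi> \<psi>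
  proof (rule dist_bound)
    fix x
    show "dist (apply_bcontfun (TT \<phi>) x) (apply_bcontfun (TT \<psi>) x) \<le> 1/2 * dist \<phi> \<psi>"
    proof -
      have "x0 \<in> {x0-h..x0+h}" using h(1) by simp
      with A_diff[OF c(1)[of x], of \<phi> \<psi>] A_diff[of x0 \<phi> \<psi>] show ?thesis
        unfolding TT T_def dist_real_def by linarith
    qed
  qed
  then have "\<exists>!\<phi>. TT \<phi> = \<phi>"
    by (intro banach_fix_type[of "1/2"]) auto
  then obtain \<Phi> where \<Phi>: "TT \<Phi> = \<Phi>" by blast
  define \<phi> where "\<phi> = apply_bcontfun \<Phi>"
  have \<phi>_cont: "continuous_on UNIV \<phi>" by (simp add: \<phi>_def)
  have \<phi>: "\<phi> x = y0 + A \<phi> (c x) - A \<phi> x0" for x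
  proof -
    have "\<phi> = T \<phi>" using TT[of \<Phi>] by (simp add: \<Phi> \<phi>_def)
    then have "\<phi> x = T \<phi> x" by (rule fun_cong)
    then show ?thesis by (simp only: T_def)
  qed
  have \<phi>_0: "\<phi> x0 = y0"
  proof -
    have "c x0 = x0" using h by (intro c(2)) simp
    then show ?thesis using \<phi>[of x0] by simp
  qed
  have der: "(\<phi> has_real_derivative g x (\<phi> x)) (at x)" if "x \<in> {x0-h<..<x0+h}" for x
  proof -
    have "(A \<phi> has_real_derivative g x (\<phi> x)) (at x within {x0-h..x0+h})"
      unfolding A_def using that
      by (intro integral_has_real_derivative continuous_on_subset[OF g_cont[OF \<phi>_cont]]) auto
    then have "(A \<phi> has_real_derivative g x (\<phi> x)) (at x)"
      using that at_within_Icc_at[of "x0-h" x "x0+h"] by simp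
    then have "((\<lambda>x. y0 + A \<phi> x - A \<phi> x0) has_real_derivative g x (\<phi> x)) (at x)"
      by (auto intro!: derivative_eq_intros)
    then show ?thesis
      by (rule has_field_derivative_transform_within_open[of _ _ _ "{x0-h<..<x0+h}"])
         (use that in \<open>auto simp: \<phi>[of y for y] c(2)\<close>)
  qed
  \<comment> \<open>The fixed point solves the clamped equation. Close to \<open>x0\<close> its
    graph stays inside the square by continuity, and there \<open>g\<close> agrees with
    \<open>f\<close>.\<close>
  have "isCont \<phi> x0"
    using \<phi>_cont by (simp add: continuous_on_eq_continuous_at)
  then obtain d where d: "d > 0" "\<And>x. \<bar>x - x0\<bar> < d \<Longrightarrow> \<bar>\<phi> x - y0\<bar> < r"
    using \<open>r > 0\<close> unfolding continuous_at_eps_delta dist_real_def \<phi>_0 by blast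
  have "(x, \<phi> x) \<in> {x0-r..x0+r} \<times> {y0-r..y0+r} \<and> (\<phi> has_real_derivative f (x, \<phi> x)) (at x)"
    if "x \<in> {x0 - min h d<..<x0 + min h d}" for x
  proof -
    have "\<bar>x - x0\<bar> < h" "\<bar>x - x0\<bar> < d"
      using that by auto
    then have x: "x \<in> {x0-h<..<x0+h}" "x \<in> {x0-r..x0+r}" "\<phi> x \<in> {y0-r..y0+r}"
      using h(2) d(2)[of x] unfolding greaterThanLessThan_iff atLeastAtMost_iff by linarith+
    then have "g x (\<phi> x) = f (x, \<phi> x)"
      by (auto simp: g_def min_def max_def)
    then show ?thesis using der[OF x(1)] x by simp
  qed
  moreover have "min h d > 0" using h(1) d(1) by simp
  ultimately show ?thesis
    using \<phi>_0 by blast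
qed

text \<open>On a compact square the partial derivative of \<open>f\<close> in \<open>y\<close> is
  bounded, which gives the Lipschitz condition by the mean value inequality.\<close>

lemma smooth_ode_local_solution:
  fixes f :: "real \<times> real \<Rightarrow> real"
  assumes "open W" "smooth_on W f" "(x0, y0) \<in> W"
  obtains h \<phi> where "h > 0" "\<phi> x0 = y0" "\<And>x. x \<in> {x0-h<..<x0+h} \<Longrightarrow> (x, \<phi> x) \<in> W"
    "\<And>x. x \<in> {x0-h<..<x0+h} \<Longrightarrow> (\<phi> has_real_derivative f (x, \<phi> x)) (at x)"
    "smooth_on {x0-h<..<x0+h} \<phi>"
proof -
  obtain e where e: "e > 0" "ball (x0, y0) e \<subseteq> W"
    using assms(1,3) openE by blast
  \<comment> \<open>The distance to the centre is at most the sum of the two coordinate distances,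
    hence at most \<open>2 * r < e\<close> on the square.\<close>
  define r where "r = e / 4"
  have r: "r > 0" using e by (simp add: r_def)
  have sub: "{x0-r..x0+r} \<times> {y0-r..y0+r} \<subseteq> W"
  proof
    fix z assume "z \<in> {x0-r..x0+r} \<times> {y0-r..y0+r}"
    then have "\<bar>fst z - x0\<bar> \<le> r" "\<bar>snd z - y0\<bar> \<le> r" by (auto simp: abs_le_iff)
    moreover have "dist z (x0, y0) \<le> \<bar>fst z - x0\<bar> + \<bar>snd z - y0\<bar>"
      using norm_Pair_le[of "fst z - x0" "snd z - y0"]
      by (cases z) (simp add: dist_norm)
    ultimately have "dist z (x0, y0) < e" using r by (simp add: r_def)
    then show "z \<in> W" using e by (auto simp: dist_commute)
  qed
  have ct: "continuous_on ({x0-r..x0+r} \<times> {y0-r..y0+r}) f"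
    using continuous_on_subset[OF smooth_on_imp_continuous_on[OF assms(2)] sub] .
  have "continuous_on ({x0-r..x0+r} \<times> {y0-r..y0+r}) (\<lambda>z. frechet_derivative f (at z) (0, 1))"
    using smooth_on_imp_continuous_on[OF smooth_on_frechet_derivative[OF assms(2)]] sub
    by (rule continuous_on_subset)
  then have "compact ((\<lambda>z. frechet_derivative f (at z) (0, 1)) ` ({x0-r..x0+r} \<times> {y0-r..y0+r}))"
    by (intro compact_continuous_image compact_Times compact_Icc)
  then have "bounded ((\<lambda>z. frechet_derivative f (at z) (0, 1)) ` ({x0-r..x0+r} \<times> {y0-r..y0+r}))"
    by (rule compact_imp_bounded)
  then obtain L where L: "L > 0" "\<forall>v\<in>(\<lambda>z. frechet_derivative f (at z) (0, 1)) `
      ({x0-r..x0+r} \<times> {y0-r..y0+r}). norm v \<le> L"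
    unfolding bounded_pos by blast
  have "\<bar>f (x, y) - f (x, z)\<bar> \<le> L * \<bar>y - z\<bar>"
    if "x \<in> {x0-r..x0+r}" "y \<in> {y0-r..y0+r}" "z \<in> {y0-r..y0+r}" for x y z
  proof (rule field_differentiable_bound[where 'a = real, unfolded real_norm_def])
    show "convex {y0-r..y0+r}" by simp
    fix u assume u: "u \<in> {y0-r..y0+r}"
    then have xu: "(x, u) \<in> {x0-r..x0+r} \<times> {y0-r..y0+r}" using that by auto
    then have fd: "(f has_derivative frechet_derivative f (at (x, u))) (at (x, u))"
      using smooth_on_has_derivative[OF assms(2)] sub by blast
    have "((\<lambda>u. (x, u)) has_derivative (\<lambda>v. (0, v))) (at u)"
      by (auto intro!: derivative_eq_intros)
    then have "((\<lambda>u. f (x, u)) has_derivative (\<lambda>v. frechet_derivative f (at (x, u)) (0, v))) (at u)"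
      using fd by (rule has_derivative_compose)
    moreover have "(\<lambda>v. frechet_derivative f (at (x, u)) (0, v)) = (*) (frechet_derivative f (at (x, u)) (0, 1))"
    proof
      fix v
      show "frechet_derivative f (at (x, u)) (0, v) = frechet_derivative f (at (x, u)) (0, 1) * v"
        using linear_scale[OF has_derivative_linear[OF fd], of v "(0, 1)"] by (simp add: mult.commute)
    qed
    ultimately have "((\<lambda>u. f (x, u)) has_real_derivative frechet_derivative f (at (x, u)) (0, 1)) (at u)"
      by (simp only: has_field_derivative_def)
    then show "((\<lambda>u. f (x, u)) has_real_derivative frechet_derivative f (at (x, u)) (0, 1)) (at u within {y0-r..y0+r})"
      by (rule has_field_derivative_at_within)
    show "\<bar>frechet_derivative f (at (x, u)) (0, 1)\<bar> \<le> L"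
      using L(2) imageI[OF xu, of "\<lambda>z. frechet_derivative f (at z) (0, 1)"] by auto
  qed (use that in auto)
  from lipschitz_ode_local_solution[OF r ct this less_imp_le[OF L(1)]]
  obtain h \<phi> where h: "h > 0" "\<phi> x0 = y0" "\<And>x. x \<in> {x0-h<..<x0+h} \<Longrightarrow>
      (x, \<phi> x) \<in> {x0-r..x0+r} \<times> {y0-r..y0+r} \<and> (\<phi> has_real_derivative f (x, \<phi> x)) (at x)"
    by blast
  then have "smooth_on {x0-h<..<x0+h} \<phi>"
    using sub by (intro smooth_on_ode_solution[OF assms(1,2)]) auto
  with h(3) sub that[of h \<phi>] h(1,2) show ?thesis by blast
qed

section \<open>Tangent lines\<close>

lemma has_vector_derivative_at_0_quotient:
  assumes "(f has_vector_derivative v) (at 0)"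
  shows "((\<lambda>h. (f h - f 0) /\<^sub>R h) \<longlongrightarrow> v) (at 0)"
proof -
  have "((\<lambda>h. norm (f (0 + h) - f 0 - h *\<^sub>R v) / norm h) \<longlongrightarrow> 0) (at 0)"
    using assms by (simp only: has_vector_derivative_def has_derivative_at)
  moreover have "eventually (\<lambda>h::real. h \<noteq> 0) (at 0)"
    by (rule eventually_neq_at_within)
  then have "eventually (\<lambda>h. norm (f (0 + h) - f 0 - h *\<^sub>R v) / norm h = norm ((f h - f 0) /\<^sub>R h - v)) (at 0)"
  proof eventually_elim
    case (elim h)
    have "(f h - f 0) /\<^sub>R h - v = (f h - f 0 - h *\<^sub>R v) /\<^sub>R h"
      using elim by (simp add: scaleR_diff_right)
    then show ?case by (simp add: divide_inverse mult.commute)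
  qed
  ultimately have "((\<lambda>h. norm ((f h - f 0) /\<^sub>R h - v)) \<longlongrightarrow> 0) (at 0)"
    by (rule Lim_transform_eventually)
  then show ?thesis
    by (rule LIM_zero_cancel[OF tendsto_norm_zero_cancel])
qed

text \<open>Since the curve is embedded, \<rho> equals \<sigma> after the change of parameter
  \<open>u = \<tau> \<circ> \<rho>\<close>, but \<open>u\<close> is only known to be continuous.
  Differentiability of \<open>u\<close> is avoided: difference quotients show that
  \<open>\<bar>u t / t\<bar>\<close> converges, and boundedness of this ratio suffices to express
  the second direction as a limit of multiples of the first.\<close>

lemma curve_param_direction:
  fixes S :: "'a::euclidean_space set"
  assumes "curve_param S P \<sigma> \<epsilon> U" "curve_param S P \<rho> \<delta> V"
  shows "vector_derivative \<rho> (at 0) \<in> span {vector_derivative \<sigma> (at 0)}"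
proof -
  define v where "v = vector_derivative \<sigma> (at 0)"
  define w where "w = vector_derivative \<rho> (at 0)"
  have s: "\<epsilon> > 0" "open U" "\<sigma> 0 = P" "smooth_on {-\<epsilon><..<\<epsilon>} \<sigma>" "v \<noteq> 0"
    and r: "\<delta> > 0" "\<rho> 0 = P" "smooth_on {-\<delta><..<\<delta>} \<rho>"
    using assms by (auto simp: curve_param_def v_def)
  obtain \<tau> where \<tau>: "homeomorphism {-\<epsilon><..<\<epsilon>} (S \<inter> U) \<sigma> \<tau>"
    using assms(1) by (auto simp: curve_param_def)
  obtain \<tau>' where \<tau>': "homeomorphism {-\<delta><..<\<delta>} (S \<inter> V) \<rho> \<tau>'"
    using assms(2) by (auto simp: curve_param_def)
  have der: "(\<sigma> has_vector_derivative v) (at 0)" "(\<rho> has_vector_derivative w) (at 0)"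
    unfolding v_def w_def using s r by (auto intro!: smooth_on_has_vector_derivative)
  have P: "P \<in> S \<inter> U"
    using homeomorphism_image1[OF \<tau>] s by force
  have \<tau>P: "\<tau> P = 0"
    using homeomorphism_apply1[OF \<tau>, of 0] s by auto
  have \<rho>_lim: "(\<rho> \<longlongrightarrow> P) (at 0)"
    using has_vector_derivative_continuous[OF der(2)] r(2) by (simp add: continuous_at)
  have near: "eventually (\<lambda>t. t \<in> {-\<delta><..<\<delta>} \<and> t \<noteq> 0) (at 0)"
    using eventually_at_in_open[of "{-\<delta><..<\<delta>}" 0] r(1) by (simp add: eventually_conj_iff)
  have SU: "eventually (\<lambda>t. \<rho> t \<in> S \<inter> U) (at 0)"
  proof -
    have "eventually (\<lambda>t. \<rho> t \<in> U) (at 0)"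
      using topological_tendstoD[OF \<rho>_lim s(2)] P by auto
    then show ?thesis
      using near
    proof eventually_elim
      case (elim t)
      then show ?case using homeomorphism_image1[OF \<tau>'] by blast
    qed
  qed
  define u where "u = (\<lambda>t. \<tau> (\<rho> t))"
  have u_lim: "(u \<longlongrightarrow> 0) (at 0)"
    using continuous_on_tendsto_compose[OF homeomorphism_cont2[OF \<tau>] \<rho>_lim P SU]
    by (simp add: u_def \<tau>P)
  have u: "eventually (\<lambda>t. \<sigma> (u t) = \<rho> t \<and> u t \<noteq> 0 \<and> t \<noteq> 0) (at 0)"
    using SU near
  proof eventually_elim
    case (elim t)
    have 1: "\<sigma> (u t) = \<rho> t"
      using homeomorphism_apply2[OF \<tau> elim(1)] by (simp add: u_def)
    moreover have "u t \<noteq> 0"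
    proof
      assume "u t = 0"
      then have "\<rho> t = \<rho> 0" using 1 s r by simp
      then show False
        using homeomorphism_apply1[OF \<tau>', of t] homeomorphism_apply1[OF \<tau>', of 0] elim(2) r(1) by auto
    qed
    ultimately show ?case using elim by simp
  qed
  \<comment> \<open>\<open>u\<close> tends to 0 without taking the value 0, so the difference
    quotient of \<sigma> may be evaluated along \<open>u\<close>.\<close>
  have u_at: "filterlim u (at 0) (at 0)"
    unfolding filterlim_at using u_lim u by (auto elim: eventually_mono)
  have q: "((\<lambda>h. (\<sigma> h - P) /\<^sub>R h) \<longlongrightarrow> v) (at 0)" "((\<lambda>h. (\<rho> h - P) /\<^sub>R h) \<longlongrightarrow> w) (at 0)"
    using der[THEN has_vector_derivative_at_0_quotient] s(3) r(2) by simp_all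
  have "((\<lambda>t. (\<sigma> (u t) - P) /\<^sub>R u t) \<longlongrightarrow> v) (at 0)"
    by (rule filterlim_compose[OF q(1) u_at])
  then have A: "((\<lambda>t. (\<rho> t - P) /\<^sub>R u t) \<longlongrightarrow> v) (at 0)"
  proof (rule Lim_transform_eventually)
    show "\<forall>\<^sub>F t in at 0. (\<sigma> (u t) - P) /\<^sub>R u t = (\<rho> t - P) /\<^sub>R u t"
      using u by eventually_elim simp
  qed
  \<comment> \<open>The same chord \<open>\<rho> t - P\<close> is divided by \<open>t\<close> and by
    \<open>u t\<close>; the quotient of the norms is the ratio of the parameters, and the limit in
    the denominator is nonzero by regularity of \<sigma>.\<close>
  have "((\<lambda>t. norm ((\<rho> t - P) /\<^sub>R t) / norm ((\<rho> t - P) /\<^sub>R u t)) \<longlongrightarrow> norm w / norm v) (at 0)"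
    using s(5) by (intro tendsto_divide tendsto_norm A q(2)) auto
  moreover have "eventually (\<lambda>t. \<rho> t - P \<noteq> 0) (at 0)"
    using near
  proof eventually_elim
    case (elim t)
    then show ?case
      using homeomorphism_apply1[OF \<tau>', of t] homeomorphism_apply1[OF \<tau>', of 0] r(1,2) by auto
  qed
  then have "eventually (\<lambda>t. norm ((\<rho> t - P) /\<^sub>R t) / norm ((\<rho> t - P) /\<^sub>R u t) = \<bar>u t / t\<bar>) (at 0)"
    using u
  proof eventually_elim
    case (elim t)
    then have "norm (\<rho> t - P) \<noteq> 0" "\<bar>t\<bar> \<noteq> 0" "\<bar>u t\<bar> \<noteq> 0" by simp_all
    then show ?case by (simp add: divide_simps)
  qed
  ultimately have "((\<lambda>t. \<bar>u t / t\<bar>) \<longlongrightarrow> norm w / norm v) (at 0)"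
    by (rule Lim_transform_eventually)
  then have "((\<lambda>t. \<bar>u t / t\<bar> * norm ((\<rho> t - P) /\<^sub>R u t - v)) \<longlongrightarrow> norm w / norm v * norm (v - v)) (at 0)"
    by (intro tendsto_mult tendsto_norm tendsto_diff A tendsto_const)
  then have "((\<lambda>t. \<bar>u t / t\<bar> * norm ((\<rho> t - P) /\<^sub>R u t - v)) \<longlongrightarrow> 0) (at 0)"
    by simp
  moreover have "eventually (\<lambda>t. \<bar>u t / t\<bar> * norm ((\<rho> t - P) /\<^sub>R u t - v)
      = norm ((\<rho> t - P) /\<^sub>R t - (u t / t) *\<^sub>R v)) (at 0)"
    using u
  proof eventually_elim
    case (elim t)
    then have "u t / t * inverse (u t) = inverse t"
      by (simp add: divide_inverse)
    then have "(\<rho> t - P) /\<^sub>R t - (u t / t) *\<^sub>R v = (u t / t) *\<^sub>R ((\<rho> t - P) /\<^sub>R u t - v)"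
      by (simp only: scaleR_diff_right scaleR_scaleR)
    then show ?case by (simp only: norm_scaleR real_norm_def)
  qed
  ultimately have "((\<lambda>t. norm ((\<rho> t - P) /\<^sub>R t - (u t / t) *\<^sub>R v)) \<longlongrightarrow> 0) (at 0)"
    by (rule Lim_transform_eventually)
  then have "((\<lambda>t. (\<rho> t - P) /\<^sub>R t - (u t / t) *\<^sub>R v) \<longlongrightarrow> 0) (at 0)"
    by (rule tendsto_norm_zero_cancel)
  from tendsto_diff[OF q(2) this] have "((\<lambda>t. (u t / t) *\<^sub>R v) \<longlongrightarrow> w) (at 0)"
    by simp
  \<comment> \<open>A line is closed, so a limit of multiples of \<open>v\<close> remains on it,
    even though no limit of the signed ratio \<open>u t / t\<close> has been found.\<close>
  then have "w \<in> span {v}"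
    by (rule Lim_in_closed_set[OF closed_subspace[OF subspace_span], rotated 2])
       (auto intro: always_eventually simp: span_singleton)
  then show ?thesis by (simp add: v_def w_def)
qed

text \<open>Independence of the parametrisation: the union over all parametrisations in the
  definition collapses to a single line, computable from any one of them.\<close>

lemma tangent_line_eq:
  fixes S :: "'a::euclidean_space set"
  assumes "curve_param S P \<sigma> \<epsilon> U"
  shows "tangent_line S P = span {vector_derivative \<sigma> (at 0)}"
proof
  show "span {vector_derivative \<sigma> (at 0)} \<subseteq> tangent_line S P"
    unfolding tangent_line_def using assms by blast
  show "tangent_line S P \<subseteq> span {vector_derivative \<sigma> (at 0)}"
  proof
    fix v assume "v \<in> tangent_line S P"
    then obtain \<rho> \<delta> V where \<rho>: "curve_param S P \<rho> \<delta> V" "v \<in> span {vector_derivative \<rho> (at 0)}"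
      unfolding tangent_line_def by blast
    have "span {vector_derivative \<rho> (at 0)} \<subseteq> span {vector_derivative \<sigma> (at 0)}"
      using curve_param_direction[OF assms \<rho>(1)] by (intro span_minimal subspace_span) simp
    with \<rho>(2) show "v \<in> span {vector_derivative \<sigma> (at 0)}" by blast
  qed
qed

lemma curve_param_tangent_line_eqI:
  fixes S T :: "'a::euclidean_space set"
  assumes "curve_param S P \<sigma> \<epsilon> U" "curve_param T P \<rho> \<delta> V"
    and "vector_derivative \<sigma> (at 0) = k *\<^sub>R vector_derivative \<rho> (at 0)"
  shows "tangent_line S P = tangent_line T P"
proof -
  have "vector_derivative \<sigma> (at 0) \<noteq> 0"
    using assms(1) by (auto simp: curve_param_def)
  then have "k \<noteq> 0" using assms(3) by auto
  then have "span {k *\<^sub>R vector_derivative \<rho> (at 0)} = span {vector_derivative \<rho> (at 0)}"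
    using span_image_scale[of "{vector_derivative \<rho> (at 0)}" "\<lambda>_. k"] by simp
  then show ?thesis
    using tangent_line_eq[OF assms(1)] tangent_line_eq[OF assms(2)] assms(3) by simp
qed

text \<open>Allows a parametrisation to be oriented so that negative parameters belong to the left
  branch.\<close>

lemma curve_param_reverse:
  assumes "curve_param S P \<sigma> \<epsilon> U"
  shows "curve_param S P (\<lambda>t. \<sigma> (- t)) \<epsilon> U"
    and "vector_derivative (\<lambda>t. \<sigma> (- t)) (at 0) = - vector_derivative \<sigma> (at 0)"
proof -
  define I where "I = {-\<epsilon><..<\<epsilon>}"
  have I: "open I" "uminus ` I = I"
    by (auto simp: I_def)
  have s: "\<epsilon> > 0" "open U" "\<sigma> 0 = P" "smooth_on I \<sigma>"
    "\<And>t. t \<in> I \<Longrightarrow> vector_derivative \<sigma> (at t) \<noteq> 0"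
    using assms by (auto simp: curve_param_def I_def)
  obtain \<tau> where \<tau>: "homeomorphism I (S \<inter> U) \<sigma> \<tau>"
    using assms by (auto simp: curve_param_def I_def)
  have neg: "- t \<in> I" if "t \<in> I" for t using that by (auto simp: I_def)
  have sm: "smooth_on I (\<lambda>t. \<sigma> (- t))"
    by (rule smooth_on_compose[OF I(1) I(1) _ _ s(4)])
       (use I smooth_on_bounded_linear[OF I(1) bounded_linear_minus[OF bounded_linear_ident]] in simp_all)
  have vd: "vector_derivative (\<lambda>t. \<sigma> (- t)) (at t) = - vector_derivative \<sigma> (at (- t))" if "t \<in> I" for t
  proof -
    have "(\<sigma> has_vector_derivative vector_derivative \<sigma> (at (- t))) (at (- t))"
      by (rule smooth_on_has_vector_derivative[OF s(4) neg[OF that]])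
    moreover have "(uminus has_vector_derivative (-1::real)) (at t)"
      by (auto intro!: derivative_eq_intros)
    ultimately have "((\<sigma> \<circ> uminus) has_vector_derivative (-1) *\<^sub>R vector_derivative \<sigma> (at (- t))) (at t)"
      by (intro vector_diff_chain_at)
    then show ?thesis by (simp add: vector_derivative_at o_def)
  qed
  have "homeomorphism I I uminus uminus"
    using I(2) by (intro homeomorphismI) (auto intro: continuous_on_minus continuous_on_id)
  from homeomorphism_compose[OF this \<tau>] have "homeomorphism I (S \<inter> U) (\<lambda>t. \<sigma> (- t)) (uminus \<circ> \<tau>)"
    by (simp add: o_def)
  then show "curve_param S P (\<lambda>t. \<sigma> (- t)) \<epsilon> U"
    unfolding curve_param_def I_def[symmetric] using s sm vd neg by auto
  show "vector_derivative (\<lambda>t. \<sigma> (- t)) (at 0) = - vector_derivative \<sigma> (at 0)"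
    using vd[of 0] s(1) by (simp add: I_def)
qed

lemma curve_param_mem: "curve_param S P \<sigma> \<epsilon> U \<Longrightarrow> t \<in> {-\<epsilon><..<\<epsilon>} \<Longrightarrow> \<sigma> t \<in> S"
  unfolding curve_param_def using homeomorphism_image1 by blast

section \<open>Projection of space curves\<close>

lemma isCont_eventually_nhds:
  assumes "isCont f x" "open S" "f x \<in> S"
  shows "eventually (\<lambda>t. f t \<in> S) (nhds x)"
  using assms unfolding continuous_at_open eventually_nhds by blast

lemma isCont_real_nearE:
  fixes f :: "real \<Rightarrow> 'a::topological_space"
  assumes "isCont f x" "open S" "f x \<in> S"
  obtains d where "d > 0" "\<And>t. \<bar>t - x\<bar> < d \<Longrightarrow> f t \<in> S"
  using isCont_eventually_nhds[OF assms] unfolding eventually_nhds_metric dist_real_def by blast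

lemma legendre_eq: "legendre = (\<lambda>q. (fst q, fst (snd q)))"
  by auto

lemma bounded_linear_legendre: "bounded_linear legendre"
  unfolding legendre_eq
  by (intro bounded_linear_Pair bounded_linear_fst bounded_linear_fst_comp bounded_linear_snd)

lemma frechet_derivative_legendre: "frechet_derivative legendre (at q) = legendre"
  using bounded_linear_imp_has_derivative[OF bounded_linear_legendre, of "at q"]
  by (simp add: frechet_derivative_at[symmetric])

lemma vector_derivative_legendre:
  assumes "\<gamma> differentiable at t"
  shows "vector_derivative (legendre \<circ> \<gamma>) (at t) = legendre (vector_derivative \<gamma> (at t))"
proof -
  have "(\<gamma> has_vector_derivative vector_derivative \<gamma> (at t)) (at t)"
    using assms by (simp add: vector_derivative_works)
  then have "((\<lambda>s. legendre (\<gamma> s)) has_vector_derivative legendre (vector_derivative \<gamma> (at t))) (at t)"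
    by (rule bounded_linear.has_vector_derivative[OF bounded_linear_legendre])
  then show ?thesis by (simp add: vector_derivative_at o_def)
qed

text \<open>A nonzero \<open>x\<close>-component of the velocity makes \<open>x\<close> a local
  parameter, so the projected arc is embedded. The hypothesis \<open>proper\<close> keeps other
  points of \<open>S\<close> from projecting into the neighbourhood. The last conclusion records the
  entire preimage of \<open>U\<close> in \<open>S\<close>; it serves later to locate every
  inflection near the folded point.\<close>

lemma curve_param_legendre:
  assumes cp: "curve_param S Q \<sigma> \<epsilon> V"
    and x: "fst (vector_derivative \<sigma> (at 0)) \<noteq> 0"
    and proper: "\<And>O1. open O1 \<Longrightarrow> Q \<in> O1 \<Longrightarrow>
      \<exists>U. open U \<and> legendre Q \<in> U \<and> (\<forall>q\<in>S. legendre q \<in> U \<longrightarrow> q \<in> O1)"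
    and \<delta>: "\<delta> > 0" and W: "open W" "legendre Q \<in> W"
  obtains \<eta> U where "\<eta> > 0" "\<eta> \<le> \<epsilon>" "\<eta> \<le> \<delta>" "U \<subseteq> W"
    "curve_param (legendre ` S) (legendre Q) (legendre \<circ> \<sigma>) \<eta> U"
    "{q \<in> S. legendre q \<in> U} = \<sigma> ` {-\<eta><..<\<eta>}"
proof -
  obtain \<tau> where \<tau>: "homeomorphism {-\<epsilon><..<\<epsilon>} (S \<inter> V) \<sigma> \<tau>"
    using cp by (auto simp: curve_param_def)
  have s: "\<epsilon> > 0" "open V" "\<sigma> 0 = Q" "smooth_on {-\<epsilon><..<\<epsilon>} \<sigma>"
    using cp by (auto simp: curve_param_def)
  define X where "X = (\<lambda>t. fst (\<sigma> t))"
  define X' where "X' = (\<lambda>t. fst (vector_derivative \<sigma> (at t)))"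
  have X: "(X has_real_derivative X' t) (at t)" if "t \<in> {-\<epsilon><..<\<epsilon>}" for t
    unfolding X_def X'_def has_real_derivative_iff_has_vector_derivative
    by (rule bounded_linear.has_vector_derivative[OF bounded_linear_fst smooth_on_has_vector_derivative[OF s(4) that]])
  have "continuous_on {-\<epsilon><..<\<epsilon>} X'"
    unfolding X'_def
    by (intro continuous_on_fst smooth_on_imp_continuous_on smooth_on_vector_derivative s(4)) simp
  then have "isCont X' 0"
    using s(1) by (simp add: continuous_on_eq_continuous_at)
  then obtain d where d: "d > 0" "\<And>t. \<bar>t\<bar> < d \<Longrightarrow> X' t \<noteq> 0"
    using x isCont_real_nearE[of 0 X' "- {0}"] by (auto simp: X'_def)
  define \<eta>1 where "\<eta>1 = min d (min \<epsilon> \<delta>)"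
  have \<eta>1: "\<eta>1 > 0" "\<eta>1 \<le> d" "\<eta>1 \<le> \<epsilon>" "\<eta>1 \<le> \<delta>"
    using d s \<delta> by (auto simp: \<eta>1_def)
  have inj: "inj_on X {-\<eta>1<..<\<eta>1}"
  proof (rule linorder_inj_onI)
    fix u v assume uv: "u < v" "u \<in> {-\<eta>1<..<\<eta>1}" "v \<in> {-\<eta>1<..<\<eta>1}"
    have "(X has_real_derivative X' t) (at t)" if "u \<le> t" "t \<le> v" for t
      using that uv \<eta>1 by (intro X) auto
    then obtain z where z: "u < z" "z < v" "X v - X u = (v - u) * X' z"
      using MVT2[OF uv(1), of X X'] by blast
    then have "X' z \<noteq> 0" using uv \<eta>1 by (intro d(2)) auto
    then show "X u \<noteq> X v" using z uv(1) by auto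
  qed auto
  \<comment> \<open>The homeomorphism condition cuts the shortened arc out of \<open>S\<close> by an
    open set, to which \<open>proper\<close> can be applied.\<close>
  have "openin (top_of_set {-\<epsilon><..<\<epsilon>}) {-\<eta>1<..<\<eta>1}"
    using \<eta>1 by (intro open_subset) auto
  then have "openin (top_of_set (S \<inter> V)) (\<sigma> ` {-\<eta>1<..<\<eta>1})"
    by (rule homeomorphism_imp_open_map[OF \<tau>])
  then obtain O1 where O1: "open O1" "\<sigma> ` {-\<eta>1<..<\<eta>1} = (S \<inter> V) \<inter> O1"
    unfolding openin_open by blast
  have "Q \<in> \<sigma> ` {-\<eta>1<..<\<eta>1}" using s(3) \<eta>1(1) by force
  then have "Q \<in> V \<inter> O1" using O1 by blast
  then obtain U1 where U1: "open U1" "legendre Q \<in> U1" "\<And>q. q \<in> S \<Longrightarrow> legendre q \<in> U1 \<Longrightarrow> q \<in> V \<inter> O1"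
    using proper[of "V \<inter> O1"] s(2) O1(1) by blast
  have \<sigma>_cont: "continuous_on {-\<epsilon><..<\<epsilon>} \<sigma>"
    using smooth_on_imp_continuous_on[OF s(4)] .
  have "isCont \<sigma> 0" using \<sigma>_cont s(1) by (simp add: continuous_on_eq_continuous_at)
  then have "isCont (\<lambda>t. legendre (\<sigma> t)) 0"
    by (rule bounded_linear.isCont[OF bounded_linear_legendre])
  then obtain e where e: "e > 0" "\<And>t. \<bar>t\<bar> < e \<Longrightarrow> legendre (\<sigma> t) \<in> U1 \<inter> W"
    using isCont_real_nearE[of 0 "\<lambda>t. legendre (\<sigma> t)" "U1 \<inter> W"] U1 W s(3) by auto
  define \<eta> where "\<eta> = min e \<eta>1"
  have \<eta>: "\<eta> > 0" "\<eta> \<le> e" "\<eta> \<le> \<eta>1" "\<eta> \<le> \<epsilon>" "\<eta> \<le> \<delta>" "{-\<eta><..<\<eta>} \<subseteq> {-\<eta>1<..<\<eta>1}"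
    using e \<eta>1 by (auto simp: \<eta>_def)
  have X_cont: "continuous_on {-\<eta><..<\<eta>} X"
    unfolding X_def by (intro continuous_on_fst continuous_on_subset[OF \<sigma>_cont]) (use \<eta> in auto)
  have X_inj: "inj_on X {-\<eta><..<\<eta>}" using inj \<eta>(6) by (rule inj_on_subset)
  obtain g where g: "homeomorphism {-\<eta><..<\<eta>} (X ` {-\<eta><..<\<eta>}) X g"
    using invariance_of_domain_homeomorphism[OF _ X_cont _ X_inj] by auto
  \<comment> \<open>The vertical strip over the \<open>x\<close>-values of the final arc removes
    those points of the longer arc whose parameter lies outside \<open>{-\<eta><..<\<eta>}\<close>;
    injectivity of \<open>X\<close> on the longer arc does the rest.\<close>
  define U where "U = (U1 \<inter> W) \<inter> (X ` {-\<eta><..<\<eta>}) \<times> UNIV"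
  have "open (X ` {-\<eta><..<\<eta>})"
    using invariance_of_domain[OF X_cont _ X_inj] by simp
  then have U_open: "open U"
    unfolding U_def by (intro open_Int open_Times U1 W open_UNIV)
  have fst_legendre: "fst (legendre q) = fst q" for q :: jet
    by (simp add: legendre_eq)
  have pre: "{q \<in> S. legendre q \<in> U} = \<sigma> ` {-\<eta><..<\<eta>}"
  proof (intro equalityI subsetI)
    fix q assume "q \<in> {q \<in> S. legendre q \<in> U}"
    then have q: "q \<in> S" "legendre q \<in> U1" "fst q \<in> X ` {-\<eta><..<\<eta>}"
      using fst_legendre[of q] by (auto simp: U_def mem_Times_iff)
    then have "q \<in> \<sigma> ` {-\<eta>1<..<\<eta>1}" using U1(3) O1(2) by blast
    then obtain t where t: "t \<in> {-\<eta>1<..<\<eta>1}" "q = \<sigma> t" by blast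
    obtain t' where t': "t' \<in> {-\<eta><..<\<eta>}" "fst q = X t'" using q(3) by blast
    have "X t = X t'" using t(2) t'(2) by (simp add: X_def)
    then have "t = t'" using inj t(1) t'(1) \<eta>(6) by (meson inj_onD subsetD)
    then show "q \<in> \<sigma> ` {-\<eta><..<\<eta>}" using t t' by blast
  next
    fix q assume "q \<in> \<sigma> ` {-\<eta><..<\<eta>}"
    then obtain t where t: "t \<in> {-\<eta><..<\<eta>}" "q = \<sigma> t" by blast
    have "q \<in> S" using t O1(2) \<eta>(6) by blast
    moreover have "legendre q \<in> U1 \<inter> W" using e(2)[of t] t \<eta>(2) by auto
    moreover have "fst (legendre q) \<in> X ` {-\<eta><..<\<eta>}"
      using t by (auto simp: fst_legendre X_def)
    ultimately show "q \<in> {q \<in> S. legendre q \<in> U}" by (simp add: U_def mem_Times_iff)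
  qed
  have im: "(legendre \<circ> \<sigma>) ` {-\<eta><..<\<eta>} = legendre ` S \<inter> U"
    unfolding image_comp[symmetric] pre[symmetric] by blast
  have hom: "homeomorphism {-\<eta><..<\<eta>} (legendre ` S \<inter> U) (legendre \<circ> \<sigma>) (g \<circ> fst)"
    unfolding im[symmetric]
  proof (rule homeomorphismI)
    have inv: "(g \<circ> fst) ((legendre \<circ> \<sigma>) t) = t" if "t \<in> {-\<eta><..<\<eta>}" for t
      using homeomorphism_apply1[OF g that] by (simp add: fst_legendre X_def)
    show "continuous_on {-\<eta><..<\<eta>} (legendre \<circ> \<sigma>)"
      using \<eta>(4) by (intro continuous_on_compose continuous_on_subset[OF \<sigma>_cont]
          bounded_linear.continuous_on[OF bounded_linear_legendre continuous_on_id]) auto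
    show "continuous_on ((legendre \<circ> \<sigma>) ` {-\<eta><..<\<eta>}) (g \<circ> fst)"
    proof (rule continuous_on_compose)
      show "continuous_on ((legendre \<circ> \<sigma>) ` {-\<eta><..<\<eta>}) fst"
        by (intro continuous_on_fst continuous_on_id)
      have "fst ` (legendre \<circ> \<sigma>) ` {-\<eta><..<\<eta>} = X ` {-\<eta><..<\<eta>}"
        by (simp add: image_image fst_legendre X_def)
      then show "continuous_on (fst ` (legendre \<circ> \<sigma>) ` {-\<eta><..<\<eta>}) g"
        using homeomorphism_cont2[OF g] by simp
    qed
    show "(g \<circ> fst) ` (legendre \<circ> \<sigma>) ` {-\<eta><..<\<eta>} \<subseteq> {-\<eta><..<\<eta>}"
      using inv by auto
    show "(g \<circ> fst) ((legendre \<circ> \<sigma>) t) = t" if "t \<in> {-\<eta><..<\<eta>}" for t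
      by (rule inv[OF that])
    show "(legendre \<circ> \<sigma>) ((g \<circ> fst) z) = z" if "z \<in> (legendre \<circ> \<sigma>) ` {-\<eta><..<\<eta>}" for z
      using inv that by auto
  qed auto
  have "smooth_on {-\<eta><..<\<eta>} \<sigma>"
    by (rule smooth_on_subset[OF s(4)]) (use \<eta>(4) in auto)
  then have sm: "smooth_on {-\<eta><..<\<eta>} (legendre \<circ> \<sigma>)"
    unfolding o_def
    by (rule smooth_on_compose[OF _ open_UNIV _ _ smooth_on_bounded_linear[OF open_UNIV bounded_linear_legendre], rotated 2])
       auto
  have nz: "vector_derivative (legendre \<circ> \<sigma>) (at t) \<noteq> 0" if "t \<in> {-\<eta><..<\<eta>}" for t
  proof -
    have "X' t \<noteq> 0" using that \<eta>(3) \<eta>1(2) by (intro d(2)) auto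
    moreover have "\<sigma> differentiable at t"
      using that \<eta>(4) by (intro smooth_on_imp_differentiable[OF s(4)]) auto
    then have "fst (vector_derivative (legendre \<circ> \<sigma>) (at t)) = X' t"
      by (simp only: vector_derivative_legendre fst_legendre X'_def)
    ultimately show ?thesis by auto
  qed
  have "curve_param (legendre ` S) (legendre Q) (legendre \<circ> \<sigma>) \<eta> U"
    unfolding curve_param_def using \<eta>(1) U_open s(3) sm nz hom by auto
  moreover have "U \<subseteq> W" by (auto simp: U_def)
  ultimately show ?thesis
    using that \<eta> pre by blast
qed

section \<open>Contours and orientation\<close>

lemma bide_eq:
  "bide a b c q = a (legendre q) + 2 * b (legendre q) * snd (snd q) + c (legendre q) * (snd (snd q))\<^sup>2"
  by (cases q) auto

lemma smooth_on_legendre: "smooth_on UNIV legendre"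
  by (rule smooth_on_bounded_linear[OF open_UNIV bounded_linear_legendre])

lemma smooth_on_compose_legendre:
  "smooth_on UNIV f \<Longrightarrow> smooth_on UNIV (\<lambda>q. f (legendre q))"
  by (rule smooth_on_compose[OF open_UNIV open_UNIV _ smooth_on_legendre]) auto

lemma bounded_linear_snd_snd: "bounded_linear (\<lambda>q. snd (snd q))"
  by (intro bounded_linear_snd_comp bounded_linear_snd)

lemma smooth_on_bide:
  assumes "smooth_on UNIV a" "smooth_on UNIV b" "smooth_on UNIV c"
  shows "smooth_on UNIV (bide a b c)"
proof -
  have p: "smooth_on UNIV (\<lambda>q::jet. snd (snd q))"
    by (rule smooth_on_bounded_linear[OF open_UNIV bounded_linear_snd_snd])
  have "bide a b c = (\<lambda>q. a (legendre q) + 2 * b (legendre q) * snd (snd q) + c (legendre q) * (snd (snd q) * snd (snd q)))"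
    by (rule ext) (simp add: bide_eq power2_eq_square)
  then show ?thesis
    using smooth_on_add[OF open_UNIV smooth_on_add[OF open_UNIV smooth_on_compose_legendre[OF assms(1)]
        smooth_on_mult[OF open_UNIV smooth_on_mult[OF open_UNIV smooth_on_const[of UNIV 2]
          smooth_on_compose_legendre[OF assms(2)]] p]]
        smooth_on_mult[OF open_UNIV smooth_on_compose_legendre[OF assms(3)] smooth_on_mult[OF open_UNIV p p]]]
    by simp
qed

lemma has_real_derivative_deriv_p:
  assumes "F differentiable at (x, y, p)"
  shows "((\<lambda>t. F (x, y, t)) has_real_derivative deriv_p F (x, y, p)) (at p)"
proof -
  have fd: "(F has_derivative frechet_derivative F (at (x, y, p))) (at (x, y, p))"
    using assms by (simp add: frechet_derivative_works)
  have "((\<lambda>t. (x, y, t)) has_derivative (\<lambda>v. (0, 0, v))) (at p)"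
    by (auto intro!: derivative_eq_intros)
  then have "((\<lambda>t. F (x, y, t)) has_derivative (\<lambda>v. frechet_derivative F (at (x, y, p)) (0, 0, v))) (at p)"
    using fd by (rule has_derivative_compose)
  moreover have "(\<lambda>v. frechet_derivative F (at (x, y, p)) (0, 0, v)) = (*) (deriv_p F (x, y, p))"
  proof
    fix v
    show "frechet_derivative F (at (x, y, p)) (0, 0, v) = deriv_p F (x, y, p) * v"
      using linear_scale[OF has_derivative_linear[OF fd], of v "(0, 0, 1)"]
      by (simp add: deriv_p_def mult.commute)
  qed
  ultimately show ?thesis by (simp only: has_field_derivative_def)
qed

lemma deriv_p_eqI:
  assumes "F differentiable at (x, y, p)" "((\<lambda>t. F (x, y, t)) has_real_derivative D) (at p)"
  shows "deriv_p F (x, y, p) = D"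
  using has_real_derivative_deriv_p[OF assms(1)] assms(2) by (rule DERIV_unique)

lemma deriv_p_bide:
  assumes "smooth_on UNIV a" "smooth_on UNIV b" "smooth_on UNIV c"
  shows "deriv_p (bide a b c) q = 2 * (b (legendre q) + c (legendre q) * snd (snd q))"
proof -
  obtain x y p where q: "q = (x, y, p)" by (cases q)
  have "((\<lambda>t. a (x, y) + 2 * b (x, y) * t + c (x, y) * t\<^sup>2) has_real_derivative
      2 * (b (x, y) + c (x, y) * p)) (at p)"
    by (auto intro!: derivative_eq_intros simp: algebra_simps)
  then show ?thesis
    unfolding q using smooth_on_imp_differentiable[OF smooth_on_bide[OF assms]]
    by (intro deriv_p_eqI) auto
qed

lemma smooth_on_deriv_p: "smooth_on UNIV F \<Longrightarrow> smooth_on UNIV (deriv_p F)"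
  using smooth_on_frechet_derivative[of UNIV F "(0, 0, 1)"] by (simp add: deriv_p_def[abs_def])

lemma deriv_p_deriv_p_bide:
  assumes "smooth_on UNIV a" "smooth_on UNIV b" "smooth_on UNIV c"
  shows "deriv_p (deriv_p (bide a b c)) q = 2 * c (legendre q)"
proof -
  obtain x y p where q: "q = (x, y, p)" by (cases q)
  have "((\<lambda>t. 2 * (b (x, y) + c (x, y) * t)) has_real_derivative 2 * c (x, y)) (at p)"
    by (auto intro!: derivative_eq_intros)
  then show ?thesis
    unfolding q
    using smooth_on_imp_differentiable[OF smooth_on_deriv_p[OF smooth_on_bide[OF assms]]]
    by (intro deriv_p_eqI) (auto simp: deriv_p_bide[OF assms])
qed

lemma bide_square:
  assumes "bide a b c q = 0"
  shows "(b (legendre q))\<^sup>2 - a (legendre q) * c (legendre q) = (b (legendre q) + c (legendre q) * snd (snd q))\<^sup>2"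
proof -
  have "B\<^sup>2 - A * C = (B + C * p)\<^sup>2" if "A + 2 * B * p + C * p\<^sup>2 = 0" for A B C p :: real
    using that by algebra
  then show ?thesis using assms unfolding bide_eq by blast
qed

text \<open>A surjection with one-dimensional kernel stays onto when restricted to a hyperplane
  exactly if the kernel is not contained in it. With the fibre direction as \<open>k\<close>, this
  describes both contours.\<close>

lemma image_kernel_eq_UNIV_iff:
  fixes M :: "'a::real_vector \<Rightarrow> 'b::real_vector" and l :: "'a \<Rightarrow> real"
  assumes "linear M" "surj M" "linear l" "l \<noteq> (\<lambda>_. 0)" and ker: "\<And>v. M v = 0 \<longleftrightarrow> v \<in> span {k}"
  shows "M ` {v. l v = 0} = UNIV \<longleftrightarrow> l k \<noteq> 0"
proof
  assume onto: "M ` {v. l v = 0} = UNIV"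
  show "l k \<noteq> 0"
  proof
    assume 0: "l k = 0"
    obtain u where u: "l u \<noteq> 0" using assms(4) by auto
    obtain v where v: "l v = 0" "M u = M v"
      using onto by (metis (mono_tags, lifting) UNIV_I imageE mem_Collect_eq)
    then have "u - v \<in> span {k}"
      using ker[of "u - v"] linear_diff[OF assms(1)] by simp
    then obtain r where "u - v = r *\<^sub>R k" by (auto simp: span_singleton)
    then have "l (u - v) = 0" using 0 linear_scale[OF assms(3)] by simp
    then show False using u v linear_diff[OF assms(3)] by auto
  qed
next
  assume k: "l k \<noteq> 0"
  have "w \<in> M ` {v. l v = 0}" for w
  proof -
    obtain u where u: "w = M u" using assms(2) by blast
    have "M k = 0" using ker by (simp add: span_base)
    then have "M (u - (l u / l k) *\<^sub>R k) = w"
      using u by (simp add: linear_diff[OF assms(1)] linear_scale[OF assms(1)])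
    moreover have "l (u - (l u / l k) *\<^sub>R k) = 0"
      using k by (simp add: linear_diff[OF assms(3)] linear_scale[OF assms(3)])
    ultimately show ?thesis by (metis (mono_tags, lifting) image_eqI mem_Collect_eq)
  qed
  then show "M ` {v. l v = 0} = UNIV" by blast
qed

lemma criminant_iff:
  assumes "F differentiable at q"
  shows "q \<in> criminant F \<longleftrightarrow> q \<in> regular_part F \<and> deriv_p F q = 0"
proof -
  have "legendre ` tangent_plane F q = UNIV \<longleftrightarrow> deriv_p F q \<noteq> 0" if "q \<in> regular_part F"
    unfolding tangent_plane_def deriv_p_def
  proof (rule image_kernel_eq_UNIV_iff)
    show "linear legendre" using bounded_linear_legendre by (rule bounded_linear.linear)
    show "surj legendre"
    proof (rule surjI)
      show "legendre (fst z, snd z, 0) = z" for z by simp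
    qed
    show "linear (frechet_derivative F (at q))" by (rule linear_frechet_derivative[OF assms])
    show "frechet_derivative F (at q) \<noteq> (\<lambda>_. 0)" using that by (simp add: regular_part_def)
    show "legendre v = 0 \<longleftrightarrow> v \<in> span {(0, 0, 1)}" for v
      by (cases v) (auto simp: span_singleton zero_prod_def image_iff)
  qed
  then show ?thesis by (auto simp: criminant_def contour_def frechet_derivative_legendre)
qed

lemma has_derivative_dual_legendre:
  "(dual_legendre has_derivative (\<lambda>(dx, dy, dp). (dp, p * dx + x * dp - dy))) (at (x, y, p))"
proof -
  have 1: "dual_legendre = (\<lambda>q. (snd (snd q), snd (snd q) * fst q - fst (snd q)))"
    by auto
  have 2: "(\<lambda>(dx, dy, dp). (dp, p * dx + x * dp - dy))
      = (\<lambda>v. (snd (snd v), (p * fst v + snd (snd v) * x) - fst (snd v)))"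
    by (auto simp: mult.commute)
  have "((\<lambda>q::jet. snd (snd q) * fst q) has_derivative (\<lambda>v. p * fst v + snd (snd v) * x)) (at (x, y, p))"
    using has_derivative_mult[OF has_derivative_snd[OF has_derivative_snd[OF has_derivative_ident]]
        has_derivative_fst[OF has_derivative_ident], of "(x, y, p)" UNIV] by simp
  then show ?thesis
    unfolding 1 2
    by (intro has_derivative_Pair has_derivative_diff has_derivative_snd has_derivative_fst has_derivative_ident)
qed

text \<open>\<open>(1, p, 0)\<close> is the direction of the \<open>\<pi>\<^sup>\<or>\<close>-fibre
  and spans the kernel of the differential of \<open>dual_legendre\<close>; the condition reads
  \<open>F\<^sub>x + p F\<^sub>y = 0\<close>.\<close>

lemma dual_contour_iff:
  assumes "F differentiable at (x, y, p)"
  shows "(x, y, p) \<in> dual_contour F \<longleftrightarrow>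
    (x, y, p) \<in> regular_part F \<and> frechet_derivative F (at (x, y, p)) (1, p, 0) = 0"
proof -
  have fd: "frechet_derivative dual_legendre (at (x, y, p)) = (\<lambda>(dx, dy, dp). (dp, p * dx + x * dp - dy))"
    using has_derivative_dual_legendre by (simp add: frechet_derivative_at[symmetric])
  have "frechet_derivative dual_legendre (at (x, y, p)) ` tangent_plane F (x, y, p) = UNIV \<longleftrightarrow>
      frechet_derivative F (at (x, y, p)) (1, p, 0) \<noteq> 0" if "(x, y, p) \<in> regular_part F"
    unfolding tangent_plane_def
  proof (rule image_kernel_eq_UNIV_iff)
    show "linear (frechet_derivative dual_legendre (at (x, y, p)))"
      using has_derivative_dual_legendre by (intro linear_frechet_derivative) (auto simp: differentiable_def)
    show "surj (frechet_derivative dual_legendre (at (x, y, p)))"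
    proof (rule surjI)
      show "frechet_derivative dual_legendre (at (x, y, p)) (0, x * fst z - snd z, fst z) = z" for z
        by (simp add: fd)
    qed
    show "linear (frechet_derivative F (at (x, y, p)))" by (rule linear_frechet_derivative[OF assms])
    show "frechet_derivative F (at (x, y, p)) \<noteq> (\<lambda>_. 0)" using that by (simp add: regular_part_def)
    show "frechet_derivative dual_legendre (at (x, y, p)) v = 0 \<longleftrightarrow> v \<in> span {(1, p, 0)}" for v
      by (cases v) (auto simp: fd span_singleton zero_prod_def image_iff)
  qed
  then show ?thesis by (auto simp: dual_contour_def contour_def)
qed

section \<open>Orientation and the sign of the projection\<close>

lemma linear_jet_expand:
  fixes l :: "jet \<Rightarrow> real"
  assumes "linear l"
  shows "l (u, v, w) = u * l (1, 0, 0) + v * l (0, 1, 0) + w * l (0, 0, 1)"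
proof -
  have "(u, v, w) = u *\<^sub>R (1, 0, 0) + v *\<^sub>R (0, 1, 0) + w *\<^sub>R (0, 0, 1::real)" by simp
  then show ?thesis
    using linear_add[OF assms] linear_scale[OF assms] by (metis real_scaleR_def)
qed

text \<open>For tangent vectors \<open>u\<close>, \<open>v\<close>, the cross product of \<open>u\<close> and \<open>v\<close> is a multiple of the normal,
  a positive one if \<open>u, v\<close> is a positive basis; its last component is \<open>det2\<close> of the projections.\<close>

lemma det2_det3_normal:
  fixes N1 N2 N3 :: real
  assumes "N1 * u1 + N2 * u2 + N3 * u3 = 0" "N1 * v1 + N2 * v2 + N3 * v3 = 0"
  shows "(N1\<^sup>2 + N2\<^sup>2 + N3\<^sup>2) * det2 (u1, u2) (v1, v2) = det3 (N1, N2, N3) (u1, u2, u3) (v1, v2, v3) * N3"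
proof -
  have "N3 * (u2 * v3 - u3 * v2) = N1 * (u1 * v2 - u2 * v1)"
    using assms by algebra
  moreover have "N3 * (u1 * v3 - u3 * v1) = - (N2 * (u1 * v2 - u2 * v1))"
    using assms by algebra
  ultimately show ?thesis
    unfolding det2_def det3.simps fst_conv snd_conv by algebra
qed

text \<open>The part of \<open>n q\<close> orthogonal to the gradient is tangent, hence orthogonal
  to \<open>n q\<close> and so to itself; it vanishes.\<close>

lemma normal_eq_scaleR_gradient:
  assumes "orientation F n" "q \<in> regular_part F" "F differentiable at q"
  obtains k where "k \<noteq> 0" "n q = k *\<^sub>R (frechet_derivative F (at q) (1, 0, 0),
    frechet_derivative F (at q) (0, 1, 0), frechet_derivative F (at q) (0, 0, 1))"
proof -
  define l where "l = frechet_derivative F (at q)"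
  define g where "g = (l (1, 0, 0), l (0, 1, 0), l (0, 0, 1))"
  have l: "l v = g \<bullet> v" for v
    using linear_jet_expand[OF linear_frechet_derivative[OF assms(3)], of "fst v" "fst (snd v)" "snd (snd v)"]
    by (simp add: l_def g_def inner_prod_def mult.commute)
  have "g \<noteq> 0"
    using assms(2) l by (auto simp: regular_part_def l_def)
  define k where "k = (n q \<bullet> g) / (g \<bullet> g)"
  define v where "v = n q - k *\<^sub>R g"
  have gv: "g \<bullet> v = 0"
    using \<open>g \<noteq> 0\<close> by (simp add: v_def k_def inner_diff_right inner_commute)
  then have "v \<in> tangent_plane F q"
    using l[of v] by (simp add: tangent_plane_def l_def)
  then have "n q \<bullet> v = 0"
    using assms(1,2) unfolding orientation_def by blast
  then have "v \<bullet> v = 0"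
    using gv unfolding v_def by (simp add: inner_diff_left)
  then have "n q = k *\<^sub>R g" by (simp add: v_def)
  moreover have "n q \<noteq> 0" using assms(1,2) by (auto simp: orientation_def)
  ultimately have "k \<noteq> 0" by auto
  then show ?thesis
    using that[of k] \<open>n q = k *\<^sub>R g\<close> unfolding g_def l_def by blast
qed

text \<open>All positive bases project with the same sign, that of the vertical component of the
  normal times \<open>s\<close>. This turns the quantifiers over bases into one inequality.\<close>

lemma sign_parts_iff:
  assumes "orientation F n" "q \<in> regular_part F" "F differentiable at q"
  shows "q \<in> left_part F n s \<longleftrightarrow> s * snd (snd (n q)) < 0"
    and "q \<in> right_part F n s \<longleftrightarrow> s * snd (snd (n q)) > 0"
proof -
  obtain k where k: "k \<noteq> 0" "n q = k *\<^sub>R (frechet_derivative F (at q) (1, 0, 0),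
    frechet_derivative F (at q) (0, 1, 0), frechet_derivative F (at q) (0, 0, 1))"
    using normal_eq_scaleR_gradient[OF assms] .
  obtain N1 N2 N3 where N: "n q = (N1, N2, N3)" by (cases "n q")
  have T: "(u1, u2, u3) \<in> tangent_plane F q \<longleftrightarrow> N1 * u1 + N2 * u2 + N3 * u3 = 0" for u1 u2 u3
  proof -
    have "N1 * u1 + N2 * u2 + N3 * u3 = k * frechet_derivative F (at q) (u1, u2, u3)"
      using k(2) N linear_jet_expand[OF linear_frechet_derivative[OF assms(3)], of u1 u2 u3]
      by (simp add: algebra_simps)
    then show ?thesis using k(1) by (simp add: tangent_plane_def)
  qed
  have pos: "N1\<^sup>2 + N2\<^sup>2 + N3\<^sup>2 > 0"
  proof -
    have "n q \<noteq> 0" using assms(1,2) unfolding orientation_def by blast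
    then have "N1\<^sup>2 + N2\<^sup>2 + N3\<^sup>2 \<noteq> 0"
      by (auto simp: N zero_prod_def add_nonneg_eq_0_iff)
    then show ?thesis by (simp add: less_le)
  qed
  have det: "sgn (s * det2 (legendre u) (legendre v)) = sgn (s * N3)"
    if "u \<in> tangent_plane F q" "v \<in> tangent_plane F q" "det3 (n q) u v > 0" for u v
  proof -
    obtain u1 u2 u3 v1 v2 v3 where uv: "u = (u1, u2, u3)" "v = (v1, v2, v3)"
      by (cases u, cases v)
    have "(N1\<^sup>2 + N2\<^sup>2 + N3\<^sup>2) * (s * det2 (u1, u2) (v1, v2)) = det3 (n q) u v * (s * N3)"
      using det2_det3_normal[of N1 u1 N2 u2 N3 u3 v1 v2 v3] that(1,2) unfolding uv T N
      by (simp only: mult.left_commute[of _ s])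
    then have "sgn (N1\<^sup>2 + N2\<^sup>2 + N3\<^sup>2) * sgn (s * det2 (u1, u2) (v1, v2)) = sgn (det3 (n q) u v) * sgn (s * N3)"
      by (metis sgn_mult)
    then show ?thesis using pos that(3) by (simp add: uv)
  qed
  \<comment> \<open>A positive basis has to be exhibited, for otherwise the conditions defining the
    parts could hold vacuously.\<close>
  have "\<exists>u\<in>tangent_plane F q. \<exists>v\<in>tangent_plane F q. det3 (n q) u v > 0"
  proof (cases "N3 = 0")
    case True
    have "(0, 0, 1) \<in> tangent_plane F q" "(N2, - N1, 0) \<in> tangent_plane F q"
      unfolding T using True by simp_all
    moreover have "det3 (n q) (0, 0, 1) (N2, - N1, 0) = N1\<^sup>2 + N2\<^sup>2 + N3\<^sup>2"
      using True by (simp add: N power2_eq_square)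
    ultimately show ?thesis using pos by metis
  next
    case False
    \<comment> \<open>The extra factor \<open>N3\<close> in the first vector makes the determinant a
      positive multiple of \<open>N3\<^sup>2\<close>, whatever the sign of
      \<open>N3\<close>.\<close>
    have "(N3 * N3, 0, - N1 * N3) \<in> tangent_plane F q" "(0, N3, - N2) \<in> tangent_plane F q"
      unfolding T by simp_all
    moreover have "det3 (n q) (N3 * N3, 0, - N1 * N3) (0, N3, - N2) = N3\<^sup>2 * (N1\<^sup>2 + N2\<^sup>2 + N3\<^sup>2)"
      by (simp add: N power2_eq_square algebra_simps)
    ultimately show ?thesis using pos False by (metis zero_less_mult_iff zero_less_power2)
  qed
  then obtain u v where uv: "u \<in> tangent_plane F q" "v \<in> tangent_plane F q" "det3 (n q) u v > 0"
    by blast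
  have sn: "snd (snd (n q)) = N3" by (simp add: N)
  show "q \<in> left_part F n s \<longleftrightarrow> s * snd (snd (n q)) < 0"
    unfolding left_part_def frechet_derivative_legendre mem_Collect_eq sn
    using assms(2) det uv by (metis sgn_less)
  show "q \<in> right_part F n s \<longleftrightarrow> s * snd (snd (n q)) > 0"
    unfolding right_part_def frechet_derivative_legendre mem_Collect_eq sn
    using assms(2) det uv by (metis sgn_greater)
qed

section \<open>Characteristics and their inflections\<close>

lemma tangent_plane_curve:
  assumes "F differentiable at (\<gamma> t)" "(\<gamma> has_vector_derivative v) (at t)"
    and "open T" "t \<in> T" "\<And>s. s \<in> T \<Longrightarrow> F (\<gamma> s) = 0"
  shows "v \<in> tangent_plane F (\<gamma> t)"
proof -
  have "(F has_derivative frechet_derivative F (at (\<gamma> t))) (at (\<gamma> t))"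
    using assms(1) by (simp add: frechet_derivative_works)
  then have "((\<lambda>s. F (\<gamma> s)) has_derivative (\<lambda>h. frechet_derivative F (at (\<gamma> t)) (h *\<^sub>R v))) (at t)"
    by (rule has_derivative_compose[OF assms(2)[unfolded has_vector_derivative_def]])
  then have "((\<lambda>s. 0) has_derivative (\<lambda>h. frechet_derivative F (at (\<gamma> t)) (h *\<^sub>R v))) (at t)"
    by (rule has_derivative_transform_within_open[OF _ assms(3,4)]) (use assms(5) in simp)
  then have "(\<lambda>h. frechet_derivative F (at (\<gamma> t)) (h *\<^sub>R v)) = (\<lambda>h. 0)"
    by (rule has_derivative_unique[OF _ has_derivative_const])
  from fun_cong[OF this, of 1] show ?thesis
    by (simp add: tangent_plane_def)
qed

lemma regular_partI: "F q = 0 \<Longrightarrow> deriv_p F q \<noteq> 0 \<Longrightarrow> q \<in> regular_part F"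
  by (auto simp: regular_part_def deriv_p_def)

text \<open>The contact plane contains the vertical direction, which is not tangent to the surface
  where \<open>F\<^sub>p\<close> is nonzero.\<close>

lemma not_characteristic_pointI: "deriv_p F q \<noteq> 0 \<Longrightarrow> \<not> characteristic_point F q"
proof
  assume nz: "deriv_p F q \<noteq> 0" and "characteristic_point F q"
  moreover have "(0, 0, 1) \<in> contact_plane q" by (cases q) simp
  ultimately have "(0, 0, 1) \<in> tangent_plane F q"
    unfolding characteristic_point_def by blast
  then show False using nz by (simp add: tangent_plane_def deriv_p_def)
qed

text \<open>Because \<open>y' = p x'\<close> along a characteristic, the second derivative of the
  contact function involves only the first derivative of \<open>p\<close>. The orders 0 and 1 vanish
  automatically, so 3-point contact is decided by this one number.\<close>

lemma inflection_legendre_iff: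
  assumes "characteristic F \<gamma> \<epsilon>"
  shows "inflection (legendre \<circ> \<gamma>) 0 \<longleftrightarrow>
    (fst (vector_derivative \<gamma> (at 0)))\<^sup>2 * snd (snd (vector_derivative \<gamma> (at 0))) = 0"
proof -
  define I where "I = {-\<epsilon><..<\<epsilon>}"
  define d where "d = (\<lambda>t. vector_derivative \<gamma> (at t))"
  have \<epsilon>: "0 \<in> I" "open I" and sm: "smooth_on I \<gamma>"
    using assms by (auto simp: characteristic_def I_def)
  define x y p where xyp: "x = (\<lambda>t. fst (\<gamma> t))" "y = (\<lambda>t. fst (snd (\<gamma> t)))" "p = (\<lambda>t. snd (snd (\<gamma> t)))"
  define x' p' where xp': "x' = (\<lambda>t. fst (d t))" "p' = (\<lambda>t. snd (snd (d t)))"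
  have der: "(\<gamma> has_vector_derivative d t) (at t)" if "t \<in> I" for t
    unfolding d_def using smooth_on_has_vector_derivative[OF sm that] .
  have y': "fst (snd (d t)) = p t * x' t" if "t \<in> I" for t
  proof -
    have "d t \<in> contact_plane (\<gamma> t)"
      using assms that unfolding characteristic_def I_def d_def by blast
    then show ?thesis
      unfolding xyp xp' by (cases "\<gamma> t"; cases "d t") auto
  qed
  have dx: "(x has_real_derivative x' t) (at t)" if "t \<in> I" for t
    unfolding xyp xp' has_real_derivative_iff_has_vector_derivative
    by (rule bounded_linear.has_vector_derivative[OF bounded_linear_fst der[OF that]])
  have dy: "(y has_real_derivative p t * x' t) (at t)" if "t \<in> I" for t
    unfolding xyp(2) y'[OF that, symmetric] has_real_derivative_iff_has_vector_derivative
    by (rule bounded_linear.has_vector_derivative[OF bounded_linear_fst_comp[OF bounded_linear_snd] der[OF that]])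
  have dp: "(p has_real_derivative p' t) (at t)" if "t \<in> I" for t
    unfolding xyp xp' has_real_derivative_iff_has_vector_derivative
    by (rule bounded_linear.has_vector_derivative[OF bounded_linear_snd_snd der[OF that]])
  have "d differentiable at 0"
    unfolding d_def using smooth_on_imp_differentiable[OF smooth_on_vector_derivative[OF \<epsilon>(2) sm] \<epsilon>(1)] .
  then have "(d has_vector_derivative vector_derivative d (at 0)) (at 0)"
    by (simp add: vector_derivative_works)
  then obtain x'' where dx': "(x' has_real_derivative x'') (at 0)"
    unfolding xp' has_real_derivative_iff_has_vector_derivative
    using bounded_linear.has_vector_derivative[OF bounded_linear_fst] by blast
  define h where "h = (\<lambda>s. det2 (vector_derivative (legendre \<circ> \<gamma>) (at 0)) ((legendre \<circ> \<gamma>) s - (legendre \<circ> \<gamma>) 0))"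
  have h: "h s = x' 0 * (y s - y 0) - p 0 * x' 0 * (x s - x 0)" for s
  proof -
    have "vector_derivative (legendre \<circ> \<gamma>) (at 0) = legendre (d 0)"
      unfolding d_def by (rule vector_derivative_legendre[OF smooth_on_imp_differentiable[OF sm \<epsilon>(1)]])
    then show ?thesis
      using y'[OF \<epsilon>(1)] by (simp add: h_def det2_def legendre_eq xyp xp')
  qed
  have dh: "(h has_real_derivative x' 0 * (x' t * (p t - p 0))) (at t)" if "t \<in> I" for t
    unfolding h[abs_def]
    by (rule derivative_eq_intros dx[OF that] dy[OF that] refl | simp add: algebra_simps)+
  have "((\<lambda>t. x' 0 * (x' t * (p t - p 0))) has_real_derivative x' 0 * (x' 0 * p' 0)) (at 0)"
    by (rule derivative_eq_intros dx' dp[OF \<epsilon>(1)] refl | simp add: algebra_simps)+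
  then have "(deriv h has_real_derivative x' 0 * (x' 0 * p' 0)) (at 0)"
    by (rule has_field_derivative_transform_within_open[OF _ \<epsilon>(2,1)])
       (use dh in \<open>auto intro: DERIV_imp_deriv[symmetric]\<close>)
  then have "deriv (deriv h) 0 = (x' 0)\<^sup>2 * p' 0"
    by (simp add: DERIV_imp_deriv power2_eq_square)
  moreover have "deriv h 0 = 0" "h 0 = 0"
    using DERIV_imp_deriv[OF dh[OF \<epsilon>(1)]] h[of 0] by simp_all
  ultimately have "zero_mult_at_least 3 h 0 \<longleftrightarrow> (x' 0)\<^sup>2 * p' 0 = 0"
    by (auto simp: zero_mult_at_least_def numeral_3_eq_3 less_Suc_eq)
  then show ?thesis
    unfolding inflection_def h_def[symmetric] by (simp only: xp' d_def)
qed

text \<open>Tangency to the surface reads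
  \<open>x' (F\<^sub>x + p F\<^sub>y) + p' F\<^sub>p = 0\<close>; with \<open>x'\<close> and
  \<open>F\<^sub>p\<close> nonzero, \<open>p'\<close> vanishes exactly when
  \<open>F\<^sub>x + p F\<^sub>y\<close> does.\<close>

lemma characteristic_inflection_iff:
  assumes ch: "characteristic F \<gamma> \<epsilon>" and F: "F differentiable at (\<gamma> 0)" and nz: "deriv_p F (\<gamma> 0) \<noteq> 0"
  shows "inflection (legendre \<circ> \<gamma>) 0 \<longleftrightarrow> \<gamma> 0 \<in> dual_contour F"
proof -
  obtain x y p where q: "\<gamma> 0 = (x, y, p)" by (cases "\<gamma> 0")
  obtain x' y' p' where v: "vector_derivative \<gamma> (at 0) = (x', y', p')" by (cases "vector_derivative \<gamma> (at 0)")
  have 0: "0 \<in> {-\<epsilon><..<\<epsilon>}" using ch by (simp add: characteristic_def)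
  then have c: "\<gamma> 0 \<in> regular_part F" "vector_derivative \<gamma> (at 0) \<noteq> 0"
    "vector_derivative \<gamma> (at 0) \<in> tangent_plane F (\<gamma> 0)"
    "vector_derivative \<gamma> (at 0) \<in> contact_plane (\<gamma> 0)"
    using ch unfolding characteristic_def by blast+
  define l where "l = frechet_derivative F (at (x, y, p))"
  have lin: "linear l" unfolding l_def by (rule linear_frechet_derivative[OF F[unfolded q]])
  have y': "y' = p * x'" using c(4) by (simp add: q v)
  have "l (x', y', p') = 0" using c(3) by (simp add: q v tangent_plane_def l_def)
  then have eq: "x' * l (1, p, 0) + p' * l (0, 0, 1) = 0"
    using linear_jet_expand[OF lin, of x' y' p'] linear_jet_expand[OF lin, of 1 p 0]
    by (simp add: y' algebra_simps)
  have l3: "l (0, 0, 1) \<noteq> 0" using nz by (simp add: q deriv_p_def l_def)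
  \<comment> \<open>If \<open>x'\<close> were 0, then \<open>y'\<close> would be 0, and
    \<open>p' F\<^sub>p = 0\<close> would force \<open>p' = 0\<close>, contrary to
    regularity.\<close>
  have "x' \<noteq> 0" using c(2) eq l3 by (auto simp: v y' zero_prod_def)
  then have "x'\<^sup>2 * p' = 0 \<longleftrightarrow> l (1, p, 0) = 0"
    using eq l3 by auto
  then show ?thesis
    using inflection_legendre_iff[OF ch] dual_contour_iff[OF F[unfolded q]] c(1)
    by (simp add: q v l_def)
qed

lemma characteristic_exists:
  assumes smooth: "smooth_on UNIV a" "smooth_on UNIV b" "smooth_on UNIV c"
    and F: "F = bide a b c" and q: "F q = 0" "deriv_p F q \<noteq> 0" "c (legendre q) \<noteq> 0"
  obtains \<gamma> \<epsilon> where "characteristic F \<gamma> \<epsilon>" "\<gamma> 0 = q"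
proof -
  obtain x0 y0 p0 where q0: "q = (x0, y0, p0)" by (cases q)
  define \<Delta> where "\<Delta> = (\<lambda>z. b z * b z - a z * c z)"
  define W where "W = {z. 0 < \<Delta> z \<and> c z \<noteq> 0}"
  define m where "m = b (x0, y0) + c (x0, y0) * p0"
  \<comment> \<open>One of the two roots of \<open>F = 0\<close> in \<open>p\<close>;
    \<open>sgn m\<close> selects the root that takes the value \<open>p0\<close> at the given
    point.\<close>
  define f where "f = (\<lambda>z. (sgn m * sqrt (\<Delta> z) - b z) / c z)"
  have \<Delta>_smooth: "smooth_on UNIV \<Delta>"
    unfolding \<Delta>_def by (intro smooth_on_diff smooth_on_mult smooth open_UNIV)
  have "W = {z. 0 < \<Delta> z} \<inter> - {z. c z = 0}" by (auto simp: W_def)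
  moreover have "open {z. 0 < \<Delta> z}"
    using smooth_on_imp_continuous_on[OF \<Delta>_smooth] by (intro open_Collect_less continuous_on_const)
  moreover have "closed {z. c z = 0}"
    using smooth_on_imp_continuous_on[OF smooth(3)] by (intro closed_Collect_eq continuous_on_const)
  ultimately have W: "open W" by (simp add: open_Int open_Compl)
  have f_smooth: "smooth_on W f"
    unfolding f_def
    by (intro smooth_on_divide smooth_on_diff smooth_on_mult smooth_on_const smooth_on_sqrt W
        smooth_on_subset[OF \<Delta>_smooth] smooth_on_subset[OF smooth(2)] smooth_on_subset[OF smooth(3)])
       (auto simp: W_def)
  have m: "m \<noteq> 0"
    using q(2) unfolding F deriv_p_bide[OF smooth] by (simp add: q0 m_def)
  have \<Delta>0: "\<Delta> (x0, y0) = m\<^sup>2"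
    using bide_square[of a b c q] q(1) by (simp add: F q0 \<Delta>_def m_def power2_eq_square)
  then have zW: "(x0, y0) \<in> W"
    using m q(3) by (simp add: W_def q0)
  have f0: "f (x0, y0) = p0"
  proof -
    have "sgn m * sqrt (\<Delta> (x0, y0)) = m" using \<Delta>0 by (simp add: sgn_mult_abs)
    then show ?thesis using q(3) by (simp add: f_def q0 m_def)
  qed
  have F0: "F (x, y, f (x, y)) = 0" and Fp: "deriv_p F (x, y, f (x, y)) \<noteq> 0" if "(x, y) \<in> W" for x y
  proof -
    have c: "c (x, y) \<noteq> 0" and D: "\<Delta> (x, y) > 0" using that by (auto simp: W_def)
    have m': "b (x, y) + c (x, y) * f (x, y) = sgn m * sqrt (\<Delta> (x, y))"
      using c by (simp add: f_def)
    then have "(b (x, y) + c (x, y) * f (x, y))\<^sup>2 = \<Delta> (x, y)"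
      using D m by (simp add: power_mult_distrib sgn_if)
    \<comment> \<open>\<open>c F = (b + c p)\<^sup>2 - \<Delta>\<close>.\<close>
    then have "c (x, y) * F (x, y, f (x, y)) = 0"
      unfolding F bide.simps \<Delta>_def by algebra
    then show "F (x, y, f (x, y)) = 0" using c by simp
    show "deriv_p F (x, y, f (x, y)) \<noteq> 0"
      unfolding F deriv_p_bide[OF smooth] using m' D m by (simp add: sgn_zero_iff)
  qed
  obtain h \<phi> where h: "h > 0" "\<phi> x0 = y0" "\<And>x. x \<in> {x0-h<..<x0+h} \<Longrightarrow> (x, \<phi> x) \<in> W"
    "\<And>x. x \<in> {x0-h<..<x0+h} \<Longrightarrow> (\<phi> has_real_derivative f (x, \<phi> x)) (at x)"
    "smooth_on {x0-h<..<x0+h} \<phi>"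
    using smooth_ode_local_solution[OF W f_smooth zW] by blast
  define z where "z = (\<lambda>t. (x0 + t, \<phi> (x0 + t)))"
  define \<gamma> where "\<gamma> = (\<lambda>t. (x0 + t, \<phi> (x0 + t), f (z t)))"
  have op: "open {-h<..<h}" by simp
  have sh: "x0 + t \<in> {x0-h<..<x0+h}" if "t \<in> {-h<..<h}" for t using that by auto
  have zW: "z t \<in> W" if "t \<in> {-h<..<h}" for t
    unfolding z_def by (rule h(3)[OF sh[OF that]])
  have x_smooth: "smooth_on {-h<..<h} (\<lambda>t. x0 + t)"
    by (intro smooth_on_add smooth_on_const smooth_on_bounded_linear bounded_linear_ident op)
  have \<phi>_smooth: "smooth_on {-h<..<h} (\<lambda>t. \<phi> (x0 + t))"
    by (rule smooth_on_compose[OF op _ _ x_smooth h(5)]) (use sh in auto)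
  have z_smooth: "smooth_on {-h<..<h} z"
    unfolding z_def by (rule smooth_on_Pair[OF op x_smooth \<phi>_smooth])
  have f_smooth: "smooth_on {-h<..<h} (\<lambda>t. f (z t))"
    by (rule smooth_on_compose[OF op W _ z_smooth f_smooth]) (use zW in auto)
  have \<gamma>_smooth: "smooth_on {-h<..<h} \<gamma>"
    unfolding \<gamma>_def by (intro smooth_on_Pair op x_smooth \<phi>_smooth f_smooth)
  have \<gamma>_der: "(\<gamma> has_vector_derivative (1, f (z t), vector_derivative (\<lambda>t. f (z t)) (at t))) (at t)"
    if "t \<in> {-h<..<h}" for t
    unfolding \<gamma>_def
  proof (intro has_vector_derivative_Pair)
    show "((\<lambda>t. x0 + t) has_vector_derivative 1) (at t)"
      by (auto intro!: derivative_eq_intros simp: has_real_derivative_iff_has_vector_derivative[symmetric])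
    have "((\<lambda>t. \<phi> (x0 + t)) has_real_derivative f (z t)) (at t)"
      using h(4)[OF sh[OF that]] DERIV_shift[of \<phi> "f (z t)" t x0] by (simp add: z_def add.commute)
    then show "((\<lambda>t. \<phi> (x0 + t)) has_vector_derivative f (z t)) (at t)"
      by (simp add: has_real_derivative_iff_has_vector_derivative)
    show "((\<lambda>t. f (z t)) has_vector_derivative vector_derivative (\<lambda>t. f (z t)) (at t)) (at t)"
      by (rule smooth_on_has_vector_derivative[OF f_smooth that])
  qed
  have F\<gamma>: "F (\<gamma> t) = 0" "deriv_p F (\<gamma> t) \<noteq> 0" if "t \<in> {-h<..<h}" for t
    using F0 Fp zW[OF that] by (simp_all add: \<gamma>_def z_def)
  have "characteristic F \<gamma> h"
    unfolding characteristic_def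
  proof (intro conjI ballI h(1) \<gamma>_smooth)
    fix t assume t: "t \<in> {-h<..<h}"
    note vd = vector_derivative_at[OF \<gamma>_der[OF t]]
    show "\<gamma> t \<in> regular_part F" using F\<gamma>[OF t] by (rule regular_partI)
    show "\<not> characteristic_point F (\<gamma> t)" using F\<gamma>(2)[OF t] by (rule not_characteristic_pointI)
    show "vector_derivative \<gamma> (at t) \<noteq> 0" unfolding vd by (simp add: zero_prod_def)
    have "vector_derivative \<gamma> (at t) \<in> contact_plane (\<gamma> t)"
      unfolding vd by (simp add: \<gamma>_def)
    moreover have "vector_derivative \<gamma> (at t) \<in> tangent_plane F (\<gamma> t)"
      unfolding vd
      by (rule tangent_plane_curve[where F = F and \<gamma> = \<gamma> and t = t, OF _ \<gamma>_der[OF t] op t F\<gamma>(1)])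
         (use smooth_on_imp_differentiable[OF smooth_on_bide[OF smooth]] in \<open>simp_all add: F\<close>)
    ultimately show "vector_derivative \<gamma> (at t) \<in> tangent_plane F (\<gamma> t) \<inter> contact_plane (\<gamma> t)"
      by blast
  qed
  moreover have "\<gamma> 0 = q" using h(2) f0 by (simp add: \<gamma>_def z_def q0)
  ultimately show ?thesis using that by blast
qed

section \<open>Folded singular points\<close>

text \<open>Here \<open>F\<close> may be any function vanishing on the curve: it is applied to the
  equation, to \<open>F\<^sub>p\<close> on the criminant, and to the coordinate equations of a
  fibre.\<close>

lemma curve_param_tangent_plane:
  assumes cp: "curve_param S P \<sigma> \<epsilon> U" and F: "F differentiable at P" "\<And>q. q \<in> S \<Longrightarrow> F q = 0"
  shows "vector_derivative \<sigma> (at 0) \<in> tangent_plane F P"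
proof -
  have s: "0 \<in> {-\<epsilon><..<\<epsilon>}" "\<sigma> 0 = P" "smooth_on {-\<epsilon><..<\<epsilon>} \<sigma>"
    using cp by (auto simp: curve_param_def)
  show ?thesis
    using tangent_plane_curve[of F \<sigma> 0, OF _ smooth_on_has_vector_derivative[OF s(3,1)] open_greaterThanLessThan s(1)]
      F curve_param_mem[OF cp] s(2) by auto
qed

text \<open>Every point of the surface over the neighbourhood is a value of one of two root
  sections. Both are continuous at the image of \<open>Q\<close> and pass through \<open>Q\<close>
  there, since \<open>Q\<close> is a double root.\<close>

lemma bide_fold_proper:
  assumes smooth: "smooth_on UNIV a" "smooth_on UNIV b" "smooth_on UNIV c"
    and F: "F = bide a b c" and Q: "F Q = 0" "deriv_p F Q = 0" "c (legendre Q) \<noteq> 0"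
    and "open S" "Q \<in> S"
  obtains U where "open U" "legendre Q \<in> U" "\<And>q. F q = 0 \<Longrightarrow> legendre q \<in> U \<Longrightarrow> q \<in> S"
proof -
  define \<Delta> where "\<Delta> = (\<lambda>z. (b z)\<^sup>2 - a z * c z)"
  \<comment> \<open>On negative arguments \<open>sqrt\<close> is the odd continuous extension, so
    the sections are continuous at the image of \<open>Q\<close> although \<Delta> may change sign
    there.\<close>
  define g where "g = (\<lambda>e z. (fst z, snd z, (e * sqrt (\<Delta> z) - b z) / c z))"
  have ct: "isCont a z" "isCont b z" "isCont c z" for z
    using smooth[THEN smooth_on_imp_continuous_on] unfolding continuous_on_eq_continuous_at[OF open_UNIV] by blast+
  have "isCont (g e) (legendre Q)" for e
    unfolding g_def \<Delta>_def using Q(3) by (intro continuous_intros ct)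
  moreover have "g e (legendre Q) = Q" for e
  proof -
    obtain x y p where q: "Q = (x, y, p)" by (cases Q)
    have m: "b (legendre Q) + c (legendre Q) * snd (snd Q) = 0"
      using Q(2) unfolding F deriv_p_bide[OF smooth] by simp
    then have "\<Delta> (legendre Q) = 0"
      using bide_square[of a b c Q] Q(1) by (simp add: F \<Delta>_def)
    then show ?thesis using m Q(3) by (simp add: g_def q field_simps eq_neg_iff_add_eq_0)
  qed
  ultimately have "eventually (\<lambda>z. g e z \<in> S) (nhds (legendre Q))" for e
    using isCont_eventually_nhds[of "legendre Q" "g e" S] assms(8,9) by simp
  moreover have "eventually (\<lambda>z. c z \<in> - {0}) (nhds (legendre Q))"
    by (rule isCont_eventually_nhds[OF ct(3)]) (use Q(3) in auto)
  ultimately have "eventually (\<lambda>z. g 1 z \<in> S \<and> g (-1) z \<in> S \<and> c z \<noteq> 0) (nhds (legendre Q))"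
    by (simp add: eventually_conj_iff)
  then obtain U where U: "open U" "legendre Q \<in> U" "\<And>z. z \<in> U \<Longrightarrow> g 1 z \<in> S \<and> g (-1) z \<in> S \<and> c z \<noteq> 0"
    unfolding eventually_nhds by blast
  have "q \<in> S" if "F q = 0" "legendre q \<in> U" for q
  proof -
    obtain x y p where q: "q = (x, y, p)" by (cases q)
    have c: "c (x, y) \<noteq> 0" using U(3) that(2) by (simp add: q)
    define m where "m = b (x, y) + c (x, y) * p"
    have "\<Delta> (x, y) = m\<^sup>2"
      using bide_square[of a b c q] that(1) by (simp add: F q \<Delta>_def m_def)
    then have "sqrt (\<Delta> (x, y)) = \<bar>m\<bar>" by simp
    then have "m = 1 * sqrt (\<Delta> (x, y)) \<or> m = (-1) * sqrt (\<Delta> (x, y))" by auto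
    moreover have "p = (m - b (x, y)) / c (x, y)" using c by (simp add: m_def)
    ultimately have "q = g 1 (x, y) \<or> q = g (-1) (x, y)" by (auto simp: g_def q)
    then show ?thesis using U(3)[OF that(2)] by (auto simp: q)
  qed
  with U(1,2) show ?thesis using that by blast
qed

text \<open>Differentiate \<open>\<Delta> \<circ> \<pi> = F\<^sub>p\<^sup>2 / 4 - c F\<close>. At
  the points considered, the square contributes nothing and the derivative of \<open>c\<close> is
  multiplied by \<open>F = 0\<close>.\<close>

lemma frechet_derivative_bide_discriminant:
  assumes smooth: "smooth_on UNIV a" "smooth_on UNIV b" "smooth_on UNIV c"
    and F: "F = bide a b c" and q: "F q = 0" "deriv_p F q = 0"
  shows "frechet_derivative (\<lambda>z. b z * b z - a z * c z) (at (legendre q)) (legendre v)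
    = - c (legendre q) * frechet_derivative F (at q) v"
proof -
  define \<Delta> where "\<Delta> = (\<lambda>z. b z * b z - a z * c z)"
  have "smooth_on UNIV \<Delta>"
    unfolding \<Delta>_def by (intro smooth_on_diff smooth_on_mult smooth open_UNIV)
  then have "(\<Delta> has_derivative frechet_derivative \<Delta> (at (legendre q))) (at (legendre q))"
    by (rule smooth_on_has_derivative) simp
  with bounded_linear_imp_has_derivative[OF bounded_linear_legendre]
  have 1: "((\<lambda>u. \<Delta> (legendre u)) has_derivative (\<lambda>v. frechet_derivative \<Delta> (at (legendre q)) (legendre v))) (at q)"
    by (rule has_derivative_compose)
  define M where "M = deriv_p F"
  have sF: "smooth_on UNIV F" unfolding F by (rule smooth_on_bide[OF smooth])
  have F': "(F has_derivative frechet_derivative F (at q)) (at q)"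
    by (rule smooth_on_has_derivative[OF sF]) simp
  have M': "(M has_derivative frechet_derivative M (at q)) (at q)"
    unfolding M_def by (rule smooth_on_has_derivative[OF smooth_on_deriv_p[OF sF]]) simp
  have c': "((\<lambda>u. c (legendre u)) has_derivative frechet_derivative (\<lambda>u. c (legendre u)) (at q)) (at q)"
    by (rule smooth_on_has_derivative[OF smooth_on_compose_legendre[OF smooth(3)]]) simp
  have "((\<lambda>u. 1/4 * (M u * M u) - c (legendre u) * F u) has_derivative
      (\<lambda>v. 1/4 * (M q * frechet_derivative M (at q) v + frechet_derivative M (at q) v * M q)
        - (c (legendre q) * frechet_derivative F (at q) v + frechet_derivative (\<lambda>u. c (legendre u)) (at q) v * F q))) (at q)"
    by (intro has_derivative_diff has_derivative_mult has_derivative_mult_right M' F' c')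
  moreover have "1/4 * (M u * M u) - c (legendre u) * F u = \<Delta> (legendre u)" for u
    unfolding M_def F deriv_p_bide[OF smooth] bide_eq \<Delta>_def by algebra
  ultimately have 2: "((\<lambda>u. \<Delta> (legendre u)) has_derivative
      (\<lambda>v. - c (legendre q) * frechet_derivative F (at q) v)) (at q)"
    using q by (simp add: M_def)
  from has_derivative_unique[OF 1 2] show ?thesis
    unfolding \<Delta>_def by (rule fun_cong)
qed

text \<open>At points with \<open>F = F\<^sub>p = 0\<close> the differentials are related by
  \<open>\<Delta>\<^sub>y = - c F\<^sub>y\<close>, so the region where \<open>c\<close> and
  \<open>\<Delta>\<^sub>y\<close> are nonzero contains the image of \<open>Q\<close>.\<close>

lemma local_equation_discriminant:
  assumes smooth: "smooth_on UNIV a" "smooth_on UNIV b" "smooth_on UNIV c"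
    and F: "F = bide a b c" and Q: "F Q = 0" "deriv_p F Q = 0" "c (legendre Q) \<noteq> 0"
    and Fy: "frechet_derivative F (at Q) (0, 1, 0) \<noteq> 0"
  obtains W where "local_equation (discriminant F) (legendre Q) (\<lambda>z. b z * b z - a z * c z) W"
proof -
  define \<Delta> where "\<Delta> = (\<lambda>z. b z * b z - a z * c z)"
  define W where "W = {z. c z \<noteq> 0} \<inter> {z. frechet_derivative \<Delta> (at z) (0, 1) \<noteq> 0}"
  have \<Delta>_smooth: "smooth_on UNIV \<Delta>"
    unfolding \<Delta>_def by (intro smooth_on_diff smooth_on_mult smooth open_UNIV)
  have sF: "smooth_on UNIV F" unfolding F by (rule smooth_on_bide[OF smooth])
  have D: "frechet_derivative \<Delta> (at (legendre q)) (0, 1) = - c (legendre q) * frechet_derivative F (at q) (0, 1, 0)"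
    if "F q = 0" "deriv_p F q = 0" for q
    using frechet_derivative_bide_discriminant[OF smooth F that, of "(0, 1, 0)"] by (simp add: \<Delta>_def)
  have "open W"
    unfolding W_def
    using smooth_on_imp_continuous_on[OF smooth(3)]
      smooth_on_imp_continuous_on[OF smooth_on_frechet_derivative[OF \<Delta>_smooth]]
    by (intro open_Int open_Collect_neq continuous_on_const)
  moreover have "legendre Q \<in> W"
    unfolding W_def using D[OF Q(1,2)] Q(3) Fy by simp
  moreover have "smooth_on W \<Delta>" by (rule smooth_on_subset[OF \<Delta>_smooth]) simp
  moreover have "\<forall>z\<in>W. frechet_derivative \<Delta> (at z) \<noteq> (\<lambda>_. 0)" by (auto simp: W_def)
  moreover have "discriminant F \<inter> W = {z \<in> W. \<Delta> z = 0}"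
  proof (intro equalityI subsetI)
    fix z assume "z \<in> discriminant F \<inter> W"
    then obtain q where q: "q \<in> criminant F" "z = legendre q" "z \<in> W"
      by (auto simp: discriminant_def)
    then have "F q = 0" "deriv_p F q = 0"
      using criminant_iff[OF smooth_on_imp_differentiable[OF sF]] by (auto simp: regular_part_def)
    then have "\<Delta> z = 0"
      using bide_square[of a b c q] deriv_p_bide[OF smooth, of q] q(2)
      by (simp add: F \<Delta>_def power2_eq_square)
    then show "z \<in> {z \<in> W. \<Delta> z = 0}" using q(3) by simp
  next
    fix z assume z: "z \<in> {z \<in> W. \<Delta> z = 0}"
    obtain x y where xy: "z = (x, y)" by (cases z)
    \<comment> \<open>The double root of the equation at a zero of \<Delta>.\<close>
    define q where "q = (x, y, - b z / c z)"
    have c: "c z \<noteq> 0" using z by (auto simp: W_def)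
    have lq: "legendre q = z" by (simp add: q_def xy)
    have "b z + c z * (- b z / c z) = 0" using c by simp
    moreover have "\<Delta> z = 0" using z by simp
    ultimately have "c z * F q = 0"
      unfolding F q_def bide.simps xy[symmetric] \<Delta>_def by algebra
    then have "F q = 0" using c by simp
    moreover have "deriv_p F q = 0"
      unfolding F deriv_p_bide[OF smooth] lq using c by (simp add: q_def)
    \<comment> \<open>Regularity of the surface at \<open>q\<close>: \<open>\<Delta>\<^sub>y\<close>
      is nonzero on \<open>W\<close>, hence so is \<open>F\<^sub>y\<close> at
      \<open>q\<close>.\<close>
    ultimately have "q \<in> criminant F"
      using D[of q] z criminant_iff[OF smooth_on_imp_differentiable[OF sF]]
      by (auto simp: lq W_def regular_part_def)
    then show "z \<in> discriminant F \<inter> W"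
      using z lq unfolding discriminant_def by blast
  qed
  ultimately show ?thesis
    using that[of W] unfolding local_equation_def \<Delta>_def by blast
qed

section \<open>Inflections of the solutions coming from a part of the surface\<close>

lemma characteristic_restrict:
  "characteristic F \<gamma> \<epsilon> \<Longrightarrow> 0 < \<delta> \<Longrightarrow> \<delta> \<le> \<epsilon> \<Longrightarrow> characteristic F \<gamma> \<delta>"
  unfolding characteristic_def by (auto intro: smooth_on_subset)

lemma mem_inflections_of_solutionsD:
  assumes "smooth_on UNIV F" "\<And>q. q \<in> L \<Longrightarrow> deriv_p F q \<noteq> 0"
    and "z \<in> inflections_of_solutions F L"
  obtains q where "q \<in> L" "q \<in> dual_contour F" "z = legendre q"
proof -
  obtain \<gamma> \<epsilon> where \<gamma>: "z = legendre (\<gamma> 0)" "characteristic F \<gamma> \<epsilon>" "\<gamma> ` {-\<epsilon><..<\<epsilon>} \<subseteq> L"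
      "inflection (legendre \<circ> \<gamma>) 0"
    using assms(3) unfolding inflections_of_solutions_def by blast
  have "\<gamma> 0 \<in> L" using \<gamma>(2,3) by (auto simp: characteristic_def)
  moreover have "\<gamma> 0 \<in> dual_contour F"
    using characteristic_inflection_iff[OF \<gamma>(2) smooth_on_imp_differentiable[OF assms(1)] assms(2)[OF \<open>\<gamma> 0 \<in> L\<close>]] \<gamma>(4)
    by simp
  ultimately show ?thesis using that \<gamma>(1) by blast
qed

text \<open>The characteristic through \<open>q\<close> need not stay in \<open>L\<close>; as
  \<open>L\<close> is relatively open, shortening it around the parameter 0 achieves this.\<close>

lemma mem_inflections_of_solutionsI:
  assumes smooth: "smooth_on UNIV a" "smooth_on UNIV b" "smooth_on UNIV c"
    and F: "F = bide a b c" and q: "q \<in> dual_contour F" "deriv_p F q \<noteq> 0" "c (legendre q) \<noteq> 0"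
    and L: "openin (top_of_set (regular_part F)) L" "q \<in> L"
  shows "legendre q \<in> inflections_of_solutions F L"
proof -
  have sF: "smooth_on UNIV F" unfolding F by (rule smooth_on_bide[OF smooth])
  have "F q = 0" using q(1) by (auto simp: dual_contour_def contour_def regular_part_def)
  then obtain \<gamma> \<epsilon> where \<gamma>: "characteristic F \<gamma> \<epsilon>" "\<gamma> 0 = q"
    using characteristic_exists[OF smooth F _ q(2,3)] by blast
  obtain S where S: "open S" "L = regular_part F \<inter> S"
    using L(1) unfolding openin_open by blast
  have g: "\<epsilon> > 0" "smooth_on {-\<epsilon><..<\<epsilon>} \<gamma>" "\<And>t. t \<in> {-\<epsilon><..<\<epsilon>} \<Longrightarrow> \<gamma> t \<in> regular_part F"
    using \<gamma>(1) by (auto simp: characteristic_def)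
  have "isCont \<gamma> 0"
    using smooth_on_imp_continuous_on[OF g(2)] g(1) by (simp add: continuous_on_eq_continuous_at)
  then obtain d where d: "d > 0" "\<And>t. \<bar>t\<bar> < d \<Longrightarrow> \<gamma> t \<in> S"
    using isCont_real_nearE[of 0 \<gamma> S] S L(2) \<gamma>(2) by auto
  define \<delta> where "\<delta> = min d \<epsilon>"
  have \<delta>: "\<delta> > 0" "\<delta> \<le> d" "\<delta> \<le> \<epsilon>" using d(1) g(1) by (auto simp: \<delta>_def)
  have ch: "characteristic F \<gamma> \<delta>" by (rule characteristic_restrict[OF \<gamma>(1) \<delta>(1,3)])
  moreover have "\<gamma> ` {-\<delta><..<\<delta>} \<subseteq> L"
  proof
    fix r assume "r \<in> \<gamma> ` {-\<delta><..<\<delta>}"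
    then obtain t where t: "t \<in> {-\<delta><..<\<delta>}" "r = \<gamma> t" by blast
    then have "\<gamma> t \<in> S" using \<delta>(2) by (intro d(2)) auto
    moreover have "\<gamma> t \<in> regular_part F" using t \<delta>(3) by (intro g(3)) auto
    ultimately show "r \<in> L" using S(2) t(2) by blast
  qed
  moreover have "inflection (legendre \<circ> \<gamma>) 0"
    using characteristic_inflection_iff[OF ch smooth_on_imp_differentiable[OF sF]] \<gamma>(2) q(1,2) by simp
  ultimately show ?thesis
    unfolding inflections_of_solutions_def using \<gamma>(2) by blast
qed

section \<open>Simple zeros, their sign change and their squares\<close>

lemma sgn_near_simple_zero:
  fixes f :: "real \<Rightarrow> real"
  assumes "(f has_real_derivative D) (at 0)" "f 0 = 0" "D \<noteq> 0"
  obtains d where "d > 0" "\<And>t. \<bar>t\<bar> < d \<Longrightarrow> sgn (f t) = sgn D * sgn t"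
proof -
  have "((\<lambda>h. (f h - f 0) /\<^sub>R h) \<longlongrightarrow> D) (at 0)"
    using assms(1) unfolding has_real_derivative_iff_has_vector_derivative
    by (rule has_vector_derivative_at_0_quotient)
  then have "((\<lambda>h. D * (f h / h)) \<longlongrightarrow> D * D) (at 0)"
    using assms(2) by (intro tendsto_mult tendsto_const) (simp add: divide_inverse mult.commute)
  moreover have "D * D \<in> {0<..}" using assms(3) by (auto simp: zero_less_mult_iff)
  ultimately have "eventually (\<lambda>h. D * (f h / h) \<in> {0<..}) (at 0)"
    by (intro topological_tendstoD) auto
  then obtain d where d: "d > 0" "\<And>h. h \<noteq> 0 \<Longrightarrow> \<bar>h\<bar> < d \<Longrightarrow> D * (f h / h) > 0"
    unfolding eventually_at by (auto simp: dist_real_def)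
  have "sgn (f t) = sgn D * sgn t" if "\<bar>t\<bar> < d" for t
  proof (cases "t = 0")
    case False
    have "sgn (D * D) = 1" using assms(3) by (auto simp: zero_less_mult_iff sgn_if)
    then have "sgn (f t) = sgn (D * D * f t)" by (simp only: sgn_mult mult_1)
    also have "D * D * f t = D * (f t / t) * (D * t)" using False by simp
    also have "sgn \<dots> = sgn (D * (f t / t)) * sgn (D * t)" by (rule sgn_mult)
    also have "sgn (D * (f t / t)) = 1" using d(2)[OF False that] by (rule sgn_pos)
    finally show ?thesis by (simp only: sgn_mult mult_1)
  qed (simp add: assms(2))
  with d(1) that show ?thesis by blast
qed

text \<open>The term with the second derivative of \<open>f\<close> carries the factor
  \<open>f 0 = 0\<close>. Applied to half of \<open>F\<^sub>p\<close> along the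
  \<open>\<pi>\<^sup>\<or>\<close>-contour, this yields exact 2-point contact from a simple
  zero.\<close>

lemma deriv_deriv_square:
  fixes f :: "real \<Rightarrow> real"
  assumes "smooth_on I f" "open I" "0 \<in> I" "f 0 = 0" "(f has_real_derivative D) (at 0)"
    and g: "\<And>t. t \<in> I \<Longrightarrow> g t = (f t)\<^sup>2"
  shows "zero_mult_at_least 2 g 0" "(deriv ^^ 2) g 0 = 2 * D\<^sup>2"
proof -
  define f' where "f' = (\<lambda>t. vector_derivative f (at t))"
  have f': "(f has_real_derivative f' t) (at t)" if "t \<in> I" for t
    unfolding f'_def has_real_derivative_iff_has_vector_derivative
    by (rule smooth_on_has_vector_derivative[OF assms(1) that])
  have D: "f' 0 = D" using DERIV_unique[OF f'[OF assms(3)] assms(5)] .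
  have "f' differentiable at 0"
    unfolding f'_def by (rule smooth_on_imp_differentiable[OF smooth_on_vector_derivative[OF assms(2,1)] assms(3)])
  then obtain f'' where f'': "(f' has_real_derivative f'') (at 0)"
    by (metis vector_derivative_works has_real_derivative_iff_has_vector_derivative)
  have dg: "(g has_real_derivative 2 * (f t * f' t)) (at t)" if "t \<in> I" for t
  proof (rule has_field_derivative_transform_within_open[OF _ assms(2) that])
    show "((\<lambda>t. (f t)\<^sup>2) has_real_derivative 2 * (f t * f' t)) (at t)"
      by (rule derivative_eq_intros f'[OF that] refl | simp)+
  qed (simp add: g)
  have "((\<lambda>t. 2 * (f t * f' t)) has_real_derivative 2 * D\<^sup>2) (at 0)"
    by (rule derivative_eq_intros f'[OF assms(3)] f'' refl | simp add: assms(4) D power2_eq_square)+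
  then have "(deriv g has_real_derivative 2 * D\<^sup>2) (at 0)"
    by (rule has_field_derivative_transform_within_open[OF _ assms(2,3)])
       (use dg in \<open>auto intro: DERIV_imp_deriv[symmetric]\<close>)
  then show "(deriv ^^ 2) g 0 = 2 * D\<^sup>2"
    by (simp add: DERIV_imp_deriv numeral_2_eq_2)
  show "zero_mult_at_least 2 g 0"
    using DERIV_imp_deriv[OF dg[OF assms(3)]] g[OF assms(3)]
    by (auto simp: zero_mult_at_least_def numeral_2_eq_2 less_Suc_eq assms(4))
qed

section \<open>Left and right parts near a folded singular point\<close>

lemma openin_sign_parts:
  assumes "orientation F n" "smooth_on UNIV F"
  shows "openin (top_of_set (regular_part F)) (left_part F n s)"
    and "openin (top_of_set (regular_part F)) (right_part F n s)"
proof -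
  have ct: "continuous_on (regular_part F) (\<lambda>q. s * snd (snd (n q)))"
    using assms(1) by (intro continuous_on_mult continuous_on_const continuous_on_snd) (simp add: orientation_def)
  have sub: "left_part F n s \<subseteq> regular_part F" "right_part F n s \<subseteq> regular_part F"
    by (auto simp: left_part_def right_part_def)
  have "left_part F n s = regular_part F \<inter> (\<lambda>q. s * snd (snd (n q))) -` {..<0}"
    "right_part F n s = regular_part F \<inter> (\<lambda>q. s * snd (snd (n q))) -` {0<..}"
    using sub sign_parts_iff[OF assms(1) _ smooth_on_imp_differentiable[OF assms(2)]] by blast+
  then show "openin (top_of_set (regular_part F)) (left_part F n s)"
    "openin (top_of_set (regular_part F)) (right_part F n s)"
    using continuous_openin_preimage_gen[OF ct, of "{..<0}"] continuous_openin_preimage_gen[OF ct, of "{0<..}"]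
    by simp_all
qed

text \<open>The vertical component of the normal is a multiple of \<open>F\<^sub>p\<close>, so both
  parts avoid the criminant.\<close>

lemma sign_parts_deriv_p_nonzero:
  assumes "orientation F n" "smooth_on UNIV F" "q \<in> left_part F n s \<or> q \<in> right_part F n s"
  shows "deriv_p F q \<noteq> 0"
proof -
  have q: "q \<in> regular_part F" using assms(3) by (auto simp: left_part_def right_part_def)
  have d: "F differentiable at q" by (rule smooth_on_imp_differentiable[OF assms(2)]) simp
  obtain k where "n q = k *\<^sub>R (frechet_derivative F (at q) (1, 0, 0),
    frechet_derivative F (at q) (0, 1, 0), frechet_derivative F (at q) (0, 0, 1))"
    using normal_eq_scaleR_gradient[OF assms(1) q d] .
  then have "snd (snd (n q)) = k * deriv_p F q" by (simp add: deriv_p_def)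
  then show ?thesis
    using assms(3) sign_parts_iff[OF assms(1) q d, of s] by auto
qed

text \<open>The normal is a multiple of the gradient, with a factor whose sign is read off the component
  \<open>F\<^sub>y\<close>, which does not vanish near \<open>Q\<close>.\<close>

lemma sgn_normal_along_curve:
  fixes \<sigma> :: "real \<Rightarrow> jet"
  assumes n: "orientation F n" and F: "smooth_on UNIV F" and \<epsilon>: "\<epsilon> > 0" and \<sigma>: "smooth_on {-\<epsilon><..<\<epsilon>} \<sigma>"
    "\<And>t. t \<in> {-\<epsilon><..<\<epsilon>} \<Longrightarrow> \<sigma> t \<in> regular_part F" "\<sigma> 0 = Q"
    and Fy: "frechet_derivative F (at Q) (0, 1, 0) \<noteq> 0"
  obtains d where "d > 0" "\<And>t. t \<in> {-\<epsilon><..<\<epsilon>} \<Longrightarrow> \<bar>t\<bar> < d \<Longrightarrow> sgn (snd (snd (n (\<sigma> t)))) =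
    sgn (fst (snd (n Q)) * frechet_derivative F (at Q) (0, 1, 0)) * sgn (deriv_p F (\<sigma> t))"
    "fst (snd (n Q)) * frechet_derivative F (at Q) (0, 1, 0) \<noteq> 0"
proof -
  define Y where "Y = (\<lambda>q. frechet_derivative F (at q) (0, 1, 0))"
  \<comment> \<open>If the normal is \<open>k\<close> times the gradient, then \<open>K\<close> is
    \<open>k F\<^sub>y\<^sup>2\<close>. Thus \<open>K\<close> has the sign of \<open>k\<close> and,
    unlike \<open>k\<close>, is visibly continuous.\<close>
  define K where "K = (\<lambda>t. fst (snd (n (\<sigma> t))) * Y (\<sigma> t))"
  have 0: "0 \<in> {-\<epsilon><..<\<epsilon>}" using \<epsilon> by simp
  have d: "F differentiable at q" for q by (rule smooth_on_imp_differentiable[OF F]) simp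
  have n_eq: "\<exists>k. k \<noteq> 0 \<and> fst (snd (n q)) = k * Y q \<and> snd (snd (n q)) = k * deriv_p F q"
    if q: "q \<in> regular_part F" for q
  proof -
    obtain k where "k \<noteq> 0" "n q = k *\<^sub>R (frechet_derivative F (at q) (1, 0, 0),
      frechet_derivative F (at q) (0, 1, 0), frechet_derivative F (at q) (0, 0, 1))"
      using normal_eq_scaleR_gradient[OF n q d] .
    then show ?thesis by (auto simp: Y_def deriv_p_def)
  qed
  have \<sigma>_cont: "continuous_on {-\<epsilon><..<\<epsilon>} \<sigma>"
    by (rule smooth_on_imp_continuous_on[OF \<sigma>(1)])
  have n_cont: "continuous_on (regular_part F) n"
    using n unfolding orientation_def by blast
  have "continuous_on {-\<epsilon><..<\<epsilon>} (\<lambda>t. n (\<sigma> t))"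
    by (rule continuous_on_compose2[OF n_cont \<sigma>_cont]) (use \<sigma>(2) in blast)
  moreover have "continuous_on {-\<epsilon><..<\<epsilon>} (\<lambda>t. Y (\<sigma> t))"
    unfolding Y_def
    by (rule continuous_on_compose2[OF smooth_on_imp_continuous_on[OF smooth_on_frechet_derivative[OF F]] \<sigma>_cont]) simp
  ultimately have "continuous_on {-\<epsilon><..<\<epsilon>} K"
    unfolding K_def by (intro continuous_on_mult continuous_on_fst continuous_on_snd)
  then have ct: "isCont K 0" using 0 by (simp add: continuous_on_eq_continuous_at)
  have K0: "K 0 \<noteq> 0"
    using n_eq[OF \<sigma>(2)[OF 0]] Fy by (auto simp: K_def Y_def \<sigma>(3))
  have "K 0 * K 0 > 0" using K0 by (auto simp: zero_less_mult_iff)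
  moreover have "isCont (\<lambda>t. K t * K 0) 0" using ct by (intro continuous_intros)
  ultimately obtain e where e: "e > 0" "\<And>t. \<bar>t\<bar> < e \<Longrightarrow> K t * K 0 > 0"
    using isCont_real_nearE[of 0 "\<lambda>t. K t * K 0" "{0<..}"] by auto
  have "sgn (snd (snd (n (\<sigma> t)))) = sgn (K 0) * sgn (deriv_p F (\<sigma> t))" if t: "t \<in> {-\<epsilon><..<\<epsilon>}" "\<bar>t\<bar> < e" for t
  proof -
    obtain k where k: "fst (snd (n (\<sigma> t))) = k * Y (\<sigma> t)" "snd (snd (n (\<sigma> t))) = k * deriv_p F (\<sigma> t)"
      using n_eq[OF \<sigma>(2)[OF t(1)]] by blast
    have "K t = k * (Y (\<sigma> t) * Y (\<sigma> t))" by (simp add: K_def k(1))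
    moreover have "sgn (K t) = sgn (K 0)"
      using e(2)[OF t(2)] by (auto simp: zero_less_mult_iff)
    moreover have "Y (\<sigma> t) \<noteq> 0" using e(2)[OF t(2)] by (auto simp: K_def)
    ultimately have "sgn k = sgn (K 0)" by (simp add: sgn_mult)
    then show ?thesis by (simp add: k(2) sgn_mult)
  qed
  with e(1) K0 that show ?thesis by (simp add: K_def Y_def \<sigma>(3))
qed

theorem theorem1p0:
  fixes a b c :: "plane \<Rightarrow> real" and F :: "jet \<Rightarrow> real" and Q :: jet
    and n :: "jet \<Rightarrow> jet" and s :: real
  assumes "smooth_on UNIV a" and "smooth_on UNIV b" and "smooth_on UNIV c"
    and "F = bide a b c"
    and "\<And>q. F q = 0 \<Longrightarrow> deriv_p F q = 0 \<Longrightarrow> deriv_p (deriv_p F) q \<noteq> 0"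
    and "orientation F n" and "s = 1 \<or> s = -1"
    and "characteristic_point F Q"
    and "not_tangent_at (criminant F) (dual_contour F) Q"
    and "not_tangent_at (fibre dual_legendre Q) (dual_contour F) Q"
    and "not_tangent_at (fibre legendre Q) (dual_contour F) Q"
  shows "quadratically_tangent (inflection_curve F) (discriminant F) (legendre Q)
    \<and> locally_separates (legendre Q) (inflection_curve F)
        (inflections_of_solutions F (left_part F n s))
        (inflections_of_solutions F (right_part F n s))"
proof -
  note smooth = assms(1-3)
  note F = assms(4)
  have sF: "smooth_on UNIV F" unfolding F by (rule smooth_on_bide[OF smooth])
  have dF: "F differentiable at q" for q by (rule smooth_on_imp_differentiable[OF sF]) simp
  have sFp: "smooth_on UNIV (deriv_p F)" by (rule smooth_on_deriv_p[OF sF])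
  have dFp: "deriv_p F differentiable at q" for q by (rule smooth_on_imp_differentiable[OF sFp]) simp
  define l where "l = frechet_derivative F (at Q)"
  define k where "k = frechet_derivative (deriv_p F) (at Q)"
  have lin: "linear l" "linear k"
    unfolding l_def k_def by (rule linear_frechet_derivative[OF dF], rule linear_frechet_derivative[OF dFp])
  obtain x0 y0 p0 where Q: "Q = (x0, y0, p0)" by (cases Q)
  have Q_reg: "Q \<in> regular_part F" and TQ: "tangent_plane F Q = contact_plane Q"
    using assms(8) by (auto simp: characteristic_point_def)
  have FQ: "F Q = 0" using Q_reg by (simp add: regular_part_def)
  \<comment> \<open>The vertical direction lies in the contact plane and the
    \<open>y\<close>-direction does not, which gives \<open>F\<^sub>p = 0\<close> and
    \<open>F\<^sub>y \<noteq> 0\<close> at \<open>Q\<close>.\<close>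
  have contact: "l v = 0 \<longleftrightarrow> fst (snd v) = p0 * fst v" for v
  proof -
    have "v \<in> tangent_plane F Q \<longleftrightarrow> v \<in> contact_plane Q" using TQ by simp
    then show ?thesis unfolding Q by (cases v) (auto simp: tangent_plane_def l_def Q)
  qed
  have FpQ: "deriv_p F Q = 0"
    using contact[of "(0, 0, 1)"] by (simp add: deriv_p_def l_def)
  have Fy: "l (0, 1, 0) \<noteq> 0" using contact[of "(0, 1, 0)"] by simp
  have Fpp: "k (0, 0, 1) \<noteq> 0"
    using assms(5)[OF FQ FpQ] by (simp add: deriv_p_def[of "deriv_p F"] k_def)
  have cQ: "c (legendre Q) \<noteq> 0"
    using assms(5)[OF FQ FpQ] unfolding F deriv_p_deriv_p_bide[OF smooth] by simp
  have dual_zero: "q \<in> regular_part F" "F q = 0" if "q \<in> dual_contour F" for q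
    using that by (auto simp: dual_contour_def contour_def regular_part_def)
  have crim_zero: "F q = 0" "deriv_p F q = 0" if "q \<in> criminant F" for q
    using that criminant_iff[OF dF] by (auto simp: regular_part_def)
  have proper: "\<exists>U. open U \<and> legendre Q \<in> U \<and> (\<forall>q\<in>S. legendre q \<in> U \<longrightarrow> q \<in> O1)"
    if S: "\<And>q. q \<in> S \<Longrightarrow> F q = 0" and O1: "open O1" "Q \<in> O1" for S O1
    using bide_fold_proper[OF smooth F FQ FpQ cQ O1] S by metis

  obtain \<sigma>0 \<epsilon> V where \<sigma>0: "curve_param (dual_contour F) Q \<sigma>0 \<epsilon> V"
    using assms(9) by (auto simp: not_tangent_at_def smooth_curve_at_def)
  obtain \<rho> \<delta> V' where \<rho>: "curve_param (criminant F) Q \<rho> \<delta> V'"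
    using assms(9) by (auto simp: not_tangent_at_def smooth_curve_at_def)
  obtain \<phi> \<mu> V'' where \<phi>: "curve_param (fibre legendre Q) Q \<phi> \<mu> V''"
    using assms(11) by (auto simp: not_tangent_at_def smooth_curve_at_def)
  define v where "v = vector_derivative \<sigma>0 (at 0)"
  define w where "w = vector_derivative \<rho> (at 0)"
  define f where "f = vector_derivative \<phi> (at 0)"
  have nz: "v \<noteq> 0" "w \<noteq> 0" "f \<noteq> 0"
    using \<sigma>0 \<rho> \<phi> by (auto simp: curve_param_def v_def w_def f_def)
  have lv: "l v = 0" "l w = 0"
    using curve_param_tangent_plane[OF \<sigma>0 dF dual_zero(2)] curve_param_tangent_plane[OF \<rho> dF crim_zero(1)]
    by (simp_all add: tangent_plane_def l_def v_def w_def)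
  have kw: "k w = 0"
    using curve_param_tangent_plane[OF \<rho> dFp crim_zero(2)] by (simp add: tangent_plane_def k_def w_def)
  have f12: "fst f = 0" "fst (snd f) = 0"
  proof -
    have 1: "((\<lambda>q::jet. fst q - x0) has_derivative (\<lambda>v. fst v)) (at Q)"
      "((\<lambda>q::jet. fst (snd q) - y0) has_derivative (\<lambda>v. fst (snd v))) (at Q)"
      by (auto intro!: derivative_eq_intros)
    have "vector_derivative \<phi> (at 0) \<in> tangent_plane (\<lambda>q. fst q - x0) Q"
      by (rule curve_param_tangent_plane[OF \<phi> differentiableI[OF 1(1)]]) (auto simp: fibre_def legendre_eq Q)
    moreover have "vector_derivative \<phi> (at 0) \<in> tangent_plane (\<lambda>q. fst (snd q) - y0) Q"
      by (rule curve_param_tangent_plane[OF \<phi> differentiableI[OF 1(2)]]) (auto simp: fibre_def legendre_eq Q)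
    ultimately show "fst f = 0" "fst (snd f) = 0"
      using 1[THEN frechet_derivative_at, symmetric] by (simp_all add: tangent_plane_def f_def)
  qed
  \<comment> \<open>A contact vector with zero \<open>x\<close>-component is vertical, hence
    parallel to the \<open>\<pi>\<close>-fibre; condition (c) forbids this for the
    \<open>\<pi>\<^sup>\<or>\<close>-contour.\<close>
  have v1: "fst v \<noteq> 0"
  proof
    assume "fst v = 0"
    then have "v = (snd (snd v) / snd (snd f)) *\<^sub>R f"
      using lv(1) contact[of v] f12 nz(3) by (cases v; cases f) (auto simp: zero_prod_def)
    then have "tangent_line (dual_contour F) Q = tangent_line (fibre legendre Q) Q"
      unfolding v_def f_def by (rule curve_param_tangent_line_eqI[OF \<sigma>0 \<phi>])
    then show False using assms(11) by (simp add: not_tangent_at_def)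
  qed
  have k_eq: "k u = fst u * k (1, p0, 0) + snd (snd u) * k (0, 0, 1)" if "l u = 0" for u
    using that contact[of u] linear_jet_expand[OF lin(2), of "fst u" "fst (snd u)" "snd (snd u)"]
      linear_jet_expand[OF lin(2), of 1 p0 0] by (cases u) (simp add: algebra_simps)
  \<comment> \<open>For a vertical \<open>w\<close> the value \<open>k w\<close> would be a nonzero
    multiple of \<open>F\<^sub>p\<^sub>p\<close>, but \<open>F\<^sub>p\<close> is constant on the
    criminant.\<close>
  have w1: "fst w \<noteq> 0"
    using k_eq[OF lv(2)] kw Fpp nz(2) contact[of w] lv(2) by (cases w) (auto simp: zero_prod_def)
  \<comment> \<open>The contact plane projects onto the line \<open>dy = p0 dx\<close>, so the two
    projected curves share their tangent.\<close>
  have leg_eq: "legendre v = (fst v / fst w) *\<^sub>R legendre w"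
    using lv contact[of v] contact[of w] w1 by (simp add: legendre_eq)
  \<comment> \<open>Within the contact plane the kernel of \<open>k\<close> is the line through
    \<open>w\<close>; membership of \<open>v\<close> would make the two contours tangent, against
    condition (a).\<close>
  have kv: "k v \<noteq> 0"
  proof
    assume "k v = 0"
    then have 1: "snd (snd v) * k (0, 0, 1) = - (fst v * k (1, p0, 0))" using k_eq[OF lv(1)] by simp
    have 2: "snd (snd w) * k (0, 0, 1) = - (fst w * k (1, p0, 0))" using k_eq[OF lv(2)] kw by simp
    have "(fst w * snd (snd v)) * k (0, 0, 1) = (fst v * snd (snd w)) * k (0, 0, 1)"
      using 1 2 by algebra
    then have "fst w * snd (snd v) = fst v * snd (snd w)" using Fpp by simp
    then have "snd (snd v) = fst v / fst w * snd (snd w)" using w1 by (simp add: field_simps)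
    then have "v = (fst v / fst w) *\<^sub>R w"
      using leg_eq by (simp add: legendre_eq prod_eq_iff)
    then have "tangent_line (dual_contour F) Q = tangent_line (criminant F) Q"
      unfolding v_def w_def by (rule curve_param_tangent_line_eqI[OF \<sigma>0 \<rho>])
    then show False using assms(9) by (simp add: not_tangent_at_def)
  qed

  define \<kappa> where "\<kappa> = fst (snd (n Q)) * l (0, 1, 0)"
  have reg_curve: "smooth_on {-\<epsilon><..<\<epsilon>} \<sigma>" "\<sigma> 0 = Q" "\<epsilon> > 0" "\<And>t. t \<in> {-\<epsilon><..<\<epsilon>} \<Longrightarrow> \<sigma> t \<in> regular_part F"
    if "curve_param (dual_contour F) Q \<sigma> \<epsilon> V" for \<sigma>
    using that curve_param_mem[OF that] dual_zero(1) by (auto simp: curve_param_def)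
  have \<kappa>: "\<kappa> \<noteq> 0"
    using sgn_normal_along_curve[OF assms(6) sF reg_curve(3)[OF \<sigma>0] reg_curve(1)[OF \<sigma>0]
        reg_curve(4)[OF \<sigma>0] reg_curve(2)[OF \<sigma>0]] Fy
    unfolding \<kappa>_def l_def by blast
  \<comment> \<open>The direction of travel is chosen so that \<open>s\<close> times the vertical
    component of the normal has the sign of the parameter. This depends on the orientations, and it
    makes negative parameters correspond to the left part.\<close>
  obtain \<sigma> where \<sigma>: "curve_param (dual_contour F) Q \<sigma> \<epsilon> V"
    and \<sigma>_der: "vector_derivative \<sigma> (at 0) = v \<or> vector_derivative \<sigma> (at 0) = - v"
    and pos: "s * \<kappa> * k (vector_derivative \<sigma> (at 0)) > 0"
  proof (cases "s * \<kappa> * k v > 0")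
    case True
    then show ?thesis using that[OF \<sigma>0] by (simp add: v_def)
  next
    case False
    moreover have "s * \<kappa> * k v \<noteq> 0" using assms(7) \<kappa> kv by auto
    ultimately have "s * \<kappa> * k v < 0" by linarith
    then have "s * \<kappa> * k (- v) > 0" by (simp add: linear_neg[OF lin(2)])
    then show ?thesis
      using that[OF curve_param_reverse(1)[OF \<sigma>0]] curve_param_reverse(2)[OF \<sigma>0] by (simp add: v_def)
  qed
  define u where "u = vector_derivative \<sigma> (at 0)"
  define M where "M = (\<lambda>t. deriv_p F (\<sigma> t))"
  note rc = reg_curve[OF \<sigma>]
  have M_smooth: "smooth_on {-\<epsilon><..<\<epsilon>} M"
    unfolding M_def by (rule smooth_on_compose[OF _ open_UNIV _ rc(1) sFp]) auto
  have M0: "M 0 = 0" by (simp add: M_def rc(2) FpQ)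
  have 0: "0 \<in> {-\<epsilon><..<\<epsilon>}" using rc(3) by simp
  have M_der: "(M has_real_derivative k u) (at 0)"
  proof -
    have "(\<sigma> has_derivative (\<lambda>h. h *\<^sub>R u)) (at 0)"
      using smooth_on_has_vector_derivative[OF rc(1) 0] unfolding u_def has_vector_derivative_def .
    moreover have "(deriv_p F has_derivative k) (at (\<sigma> 0))"
      unfolding k_def rc(2) using dFp[of Q] by (simp add: frechet_derivative_works)
    ultimately have "(M has_derivative (\<lambda>h. k (h *\<^sub>R u))) (at 0)"
      unfolding M_def by (rule has_derivative_compose)
    moreover have "(\<lambda>h. k (h *\<^sub>R u)) = (*) (k u)"
      by (rule ext) (simp add: linear_scale[OF lin(2)])
    ultimately show ?thesis by (simp only: has_field_derivative_def)
  qed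
  have ku: "k u \<noteq> 0" using pos by (auto simp: u_def)
  obtain d1 where d1: "d1 > 0" "\<And>t. \<bar>t\<bar> < d1 \<Longrightarrow> sgn (M t) = sgn (k u) * sgn t"
    using sgn_near_simple_zero[OF M_der M0 ku] by blast
  obtain d2 where d2: "d2 > 0" "\<And>t. t \<in> {-\<epsilon><..<\<epsilon>} \<Longrightarrow> \<bar>t\<bar> < d2 \<Longrightarrow>
      sgn (snd (snd (n (\<sigma> t)))) = sgn \<kappa> * sgn (M t)"
    using sgn_normal_along_curve[OF assms(6) sF rc(3,1,4,2)] Fy unfolding \<kappa>_def l_def M_def by blast
  define d where "d = min d1 d2"
  have d: "d > 0" using d1 d2 by (simp add: d_def)
  have n_sgn: "sgn (s * snd (snd (n (\<sigma> t)))) = sgn t" if "t \<in> {-\<epsilon><..<\<epsilon>}" "\<bar>t\<bar> < d" for t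
  proof -
    have "sgn (s * snd (snd (n (\<sigma> t)))) = sgn (s * \<kappa> * k u) * sgn t"
      using d1(2)[of t] d2(2)[of t] that by (simp add: d_def sgn_mult)
    then show ?thesis using pos by (simp add: u_def)
  qed
  have c_open: "open {z. c z \<noteq> 0}"
    using smooth_on_imp_continuous_on[OF smooth(3)] by (intro open_Collect_neq continuous_on_const)
  have u1: "fst (vector_derivative \<sigma> (at 0)) \<noteq> 0" using \<sigma>_der v1 by auto
  have Q_c: "legendre Q \<in> {z. c z \<noteq> 0}" using cQ by simp
  \<comment> \<open>\<open>\<eta> \<le> d\<close> keeps the sign rule valid on the whole arc, and
    \<open>c \<noteq> 0\<close> over \<open>U\<close> guarantees a characteristic through each of
    its points off the criminant.\<close>
  obtain \<eta> U where \<eta>: "\<eta> > 0" "\<eta> \<le> \<epsilon>" "\<eta> \<le> d" and U: "U \<subseteq> {z. c z \<noteq> 0}"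
    and I: "curve_param (inflection_curve F) (legendre Q) (legendre \<circ> \<sigma>) \<eta> U"
    and pre: "{q \<in> dual_contour F. legendre q \<in> U} = \<sigma> ` {-\<eta><..<\<eta>}"
    unfolding inflection_curve_def
    by (rule curve_param_legendre[OF \<sigma> u1 proper[OF dual_zero(2)] d c_open Q_c])
  obtain \<eta>' U' where D: "curve_param (discriminant F) (legendre Q) (legendre \<circ> \<rho>) \<eta>' U'"
    unfolding discriminant_def
    by (rule curve_param_legendre[OF \<rho> w1[unfolded w_def] proper[OF crim_zero(1)] d c_open Q_c])

  have tangent: "tangent_at (inflection_curve F) (discriminant F) (legendre Q)"
  proof -
    have "vector_derivative (legendre \<circ> \<rho>) (at 0) = legendre w"
      unfolding w_def using \<rho>
      by (intro vector_derivative_legendre smooth_on_imp_differentiable) (auto simp: curve_param_def)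
    moreover have "vector_derivative (legendre \<circ> \<sigma>) (at 0) = legendre u"
      unfolding u_def by (rule vector_derivative_legendre[OF smooth_on_imp_differentiable[OF rc(1) 0]])
    moreover have "\<exists>r. legendre u = r *\<^sub>R legendre w"
    proof -
      have "legendre (- v) = (- (fst v / fst w)) *\<^sub>R legendre w"
        using leg_eq linear_neg[OF bounded_linear.linear[OF bounded_linear_legendre], of v] by simp
      then show ?thesis using \<sigma>_der leg_eq unfolding u_def by metis
    qed
    ultimately have "tangent_line (inflection_curve F) (legendre Q) = tangent_line (discriminant F) (legendre Q)"
      using curve_param_tangent_line_eqI[OF I D] by metis
    then show ?thesis using I D by (auto simp: tangent_at_def smooth_curve_at_def)
  qed
  have contact2: "exact_contact 2 (inflection_curve F) (discriminant F) (legendre Q)"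
  proof -
    define \<Delta> where "\<Delta> = (\<lambda>z. b z * b z - a z * c z)"
    obtain W where W: "local_equation (discriminant F) (legendre Q) \<Delta> W"
      unfolding \<Delta>_def using local_equation_discriminant[OF smooth F FQ FpQ cQ] Fy unfolding l_def by blast
    \<comment> \<open>On the surface \<open>\<Delta>\<close> is the square of
      \<open>F\<^sub>p / 2\<close>, so the equation of the discriminant restricts to a square along
      the curve of inflections.\<close>
    have half: "(\<Delta> \<circ> (legendre \<circ> \<sigma>)) t = (M t / 2)\<^sup>2" if "t \<in> {-\<epsilon><..<\<epsilon>}" for t
    proof -
      have "bide a b c (\<sigma> t) = 0" using rc(4)[OF that] by (simp add: regular_part_def F)
      from bide_square[OF this] have "(\<Delta> \<circ> (legendre \<circ> \<sigma>)) t
          = (b (legendre (\<sigma> t)) + c (legendre (\<sigma> t)) * snd (snd (\<sigma> t)))\<^sup>2"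
        by (simp only: \<Delta>_def o_def power2_eq_square)
      also have "b (legendre (\<sigma> t)) + c (legendre (\<sigma> t)) * snd (snd (\<sigma> t)) = M t / 2"
        unfolding M_def F deriv_p_bide[OF smooth] by simp
      finally show ?thesis .
    qed
    have 1: "smooth_on {-\<epsilon><..<\<epsilon>} (\<lambda>t. M t / 2)"
      by (rule smooth_on_divide[OF _ M_smooth smooth_on_const]) auto
    have 2: "M 0 / 2 = 0" using M0 by simp
    have 3: "((\<lambda>t. M t / 2) has_real_derivative k u / 2) (at 0)"
      by (rule DERIV_cdivide[OF M_der])
    have "zero_mult_at_least 2 (\<Delta> \<circ> (legendre \<circ> \<sigma>)) 0"
      "(deriv ^^ 2) (\<Delta> \<circ> (legendre \<circ> \<sigma>)) 0 = 2 * (k u / 2)\<^sup>2"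
      by (rule deriv_deriv_square[OF 1 open_greaterThanLessThan 0 2 3 half], assumption)+
    moreover have "2 * (k u / 2)\<^sup>2 \<noteq> 0" using ku by simp
    ultimately show ?thesis
      using I W unfolding exact_contact_def by metis
  qed
  \<comment> \<open>Common to both sides. One inclusion rests on \<open>pre\<close>, by which an
    inflection over \<open>U\<close> can only come from the arc of \<sigma>; the other on the
    existence of a characteristic through each point of the arc lying in \<open>L\<close>.\<close>
  have branch: "inflections_of_solutions F L \<inter> U = (legendre \<circ> \<sigma>) ` J"
    if L: "openin (top_of_set (regular_part F)) L" "\<And>q. q \<in> L \<Longrightarrow> deriv_p F q \<noteq> 0"
      and J: "\<And>t. t \<in> {-\<eta><..<\<eta>} \<Longrightarrow> \<sigma> t \<in> L \<longleftrightarrow> t \<in> J" "J \<subseteq> {-\<eta><..<\<eta>}" for L J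
  proof (intro equalityI subsetI)
    fix z assume z: "z \<in> inflections_of_solutions F L \<inter> U"
    then obtain q where q: "q \<in> L" "q \<in> dual_contour F" "z = legendre q"
      using mem_inflections_of_solutionsD[OF sF L(2)] by blast
    then obtain t where "t \<in> {-\<eta><..<\<eta>}" "q = \<sigma> t" using pre z by blast
    then show "z \<in> (legendre \<circ> \<sigma>) ` J" using q J(1) by auto
  next
    fix z assume "z \<in> (legendre \<circ> \<sigma>) ` J"
    then obtain t where t: "t \<in> J" "z = legendre (\<sigma> t)" by auto
    then have "\<sigma> t \<in> L" "\<sigma> t \<in> dual_contour F" "legendre (\<sigma> t) \<in> U"
      using J pre by blast+
    moreover from this have "legendre (\<sigma> t) \<in> inflections_of_solutions F L"
      using U by (intro mem_inflections_of_solutionsI[OF smooth F _ _ _ L(1)] L(2)) auto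
    ultimately show "z \<in> inflections_of_solutions F L \<inter> U" using t(2) by blast
  qed
  \<comment> \<open>At \<open>t = 0\<close> the sign is 0, so the folded point belongs to neither
    branch.\<close>
  have sides: "\<sigma> t \<in> left_part F n s \<longleftrightarrow> t < 0" "\<sigma> t \<in> right_part F n s \<longleftrightarrow> t > 0"
    if "t \<in> {-\<eta><..<\<eta>}" for t
  proof -
    have t: "t \<in> {-\<epsilon><..<\<epsilon>}" "\<bar>t\<bar> < d" using that \<eta> by auto
    show "\<sigma> t \<in> left_part F n s \<longleftrightarrow> t < 0" "\<sigma> t \<in> right_part F n s \<longleftrightarrow> t > 0"
      unfolding sign_parts_iff[OF assms(6) rc(4)[OF t(1)] dF]
      using n_sgn[OF t] by (metis sgn_less, metis sgn_greater)
  qed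
  have left: "inflections_of_solutions F (left_part F n s) \<inter> U = (legendre \<circ> \<sigma>) ` {-\<eta><..<0}"
  proof (rule branch[OF openin_sign_parts(1)[OF assms(6) sF]])
    show "deriv_p F q \<noteq> 0" if "q \<in> left_part F n s" for q
      using sign_parts_deriv_p_nonzero[OF assms(6) sF] that by blast
    show "\<sigma> t \<in> left_part F n s \<longleftrightarrow> t \<in> {-\<eta><..<0}" if "t \<in> {-\<eta><..<\<eta>}" for t
      using sides(1)[OF that] that by auto
  qed (use \<eta>(1) in auto)
  have right: "inflections_of_solutions F (right_part F n s) \<inter> U = (legendre \<circ> \<sigma>) ` {0<..<\<eta>}"
  proof (rule branch[OF openin_sign_parts(2)[OF assms(6) sF]])
    show "deriv_p F q \<noteq> 0" if "q \<in> right_part F n s" for q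
      using sign_parts_deriv_p_nonzero[OF assms(6) sF] that by blast
    show "\<sigma> t \<in> right_part F n s \<longleftrightarrow> t \<in> {0<..<\<eta>}" if "t \<in> {-\<eta><..<\<eta>}" for t
      using sides(2)[OF that] that by auto
  qed (use \<eta>(1) in auto)
  show ?thesis
    unfolding quadratically_tangent_def locally_separates_def
    using tangent contact2 I left right by blast
qed

end
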